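(* Let $P\subseteq\mathbb{R}^{n}$ be a rational polyhedron. Then the following conditions are equivalent: (i) there exists a strongly regular triangulation of $P$; (ii) for each rational point $v\in P$ there exist $w\in \mathbb{Z}^n$ and $\varepsilon>0$ such that the convex segment $\mathrm{conv}(v,v+\varepsilon (w-v))$ is contained in $P$.
   Context: $n$ is a positive integer. A simplex in $\mathbb{R}^n$ is the convex hull of finitely many affinely independent points, its vertices; it is rational if all its vertices have rational coordinates. A rational polyhedron is a finite union of (closed) rational simplexes. A rational point is a point with rational coordinates. All simplicial complexes are finite; a triangulation of $P$ is a simplicial complex whose simplexes have union $P$; it is rational if all its simplexes are rational. For $v\in\mathbb{Q}^n$, $\mathrm{den}(v)$ is the lowest common denominator of the coordinates of $v$, and $\widetilde v=\mathrm{den}(v)(v,1)\in\mathbb{Z}^{n+1}$. A rational simplex is regular if the set $\{\widetilde v\}$, with $v$ ranging over its vertices, is part of a basis of the free abelian group $\mathbb{Z}^{n+1}$. A simplex is strongly regular if it is regular and the greatest common divisor of the denominators of its vertices is $1$. A rational triangulation of $P$ is strongly regular if each of its maximal simplexes is strongly regular. *)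

theory Defs
  imports "HOL-Analysis.Analysis"
begin

definition rational_point :: "real ^ 'n \<Rightarrow> bool" where
  "rational_point v \<longleftrightarrow> (\<forall>i. v $ i \<in> \<rat>)"

definition integer_point :: "real ^ 'n \<Rightarrow> bool" where
  "integer_point v \<longleftrightarrow> (\<forall>i. v $ i \<in> \<int>)"

text \<open>
  The vertices of a simplex are the affinely independent points whose convex hull it is. They are
  determined by the simplex; the definite description is only meaningful for simplexes.
\<close>

definition vertices :: "'a::euclidean_space set \<Rightarrow> 'a set" where
  "vertices S = (THE C. \<not> affine_dependent C \<and> S = convex hull C)"

lemma vertices_convex_hull:
  fixes C :: "'a::euclidean_space set"
  assumes "\<not> affine_dependent C"
  shows "vertices (convex hull C) = C"
  unfolding vertices_def
proof (rule the_equality)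
  show "\<not> affine_dependent C \<and> convex hull C = convex hull C"
    using assms by simp
next
  fix D :: "'a set"
  assume D: "\<not> affine_dependent D \<and> convex hull C = convex hull D"
  have "x \<in> D \<longleftrightarrow> x \<in> C" for x
    using D assms extreme_point_of_convex_hull_affine_independent by metis
  then show "D = C"
    by blast
qed

definition rational_simplex :: "(real ^ 'n) set \<Rightarrow> bool" where
  "rational_simplex S \<longleftrightarrow> (\<exists>k. k simplex S) \<and> (\<forall>v \<in> vertices S. rational_point v)"

definition rational_polyhedron :: "(real ^ 'n) set \<Rightarrow> bool" where
  "rational_polyhedron P \<longleftrightarrow>
    (\<exists>\<F>. finite \<F> \<and> (\<forall>S \<in> \<F>. rational_simplex S) \<and> P = \<Union>\<F>)"

text \<open>The lowest common denominator of the coordinates of a rational point.\<close>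

definition den :: "real ^ 'n \<Rightarrow> nat" where
  "den v = (LEAST d. d > 0 \<and> (\<forall>i. real d * v $ i \<in> \<int>))"

text \<open>
  The vector \<open>den v \<cdot> (v, 1)\<close> in \<open>\<int>\<^sup>n\<^sup>+\<^sup>1\<close>. The index type \<open>'n option\<close> adds one further coordinate
  \<open>None\<close> to those of \<open>v\<close>. For rational \<open>v\<close> the numbers \<open>den v * v $ i\<close> are integers, so that the
  floor merely changes the type from real to int.
\<close>

definition homogeneous :: "real ^ 'n \<Rightarrow> int ^ 'n option" where
  "homogeneous v =
    (\<chi> j. case j of Some i \<Rightarrow> \<lfloor>real (den v) * v $ i\<rfloor> | None \<Rightarrow> int (den v))"

global_interpretation int_vec: module "(*s) :: int \<Rightarrow> int ^ 'm \<Rightarrow> int ^ 'm"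
  by unfold_locales (simp_all add: vector_add_ldistrib vector_sadd_rdistrib vector_smult_assoc)

definition int_basis :: "(int ^ 'm) set \<Rightarrow> bool" where
  "int_basis B \<longleftrightarrow> int_vec.independent B \<and> int_vec.span B = UNIV"

definition regular_simplex :: "(real ^ 'n) set \<Rightarrow> bool" where
  "regular_simplex S \<longleftrightarrow>
    rational_simplex S \<and> (\<exists>B. int_basis B \<and> homogeneous ` vertices S \<subseteq> B)"

definition strongly_regular_simplex :: "(real ^ 'n) set \<Rightarrow> bool" where
  "strongly_regular_simplex S \<longleftrightarrow> regular_simplex S \<and> Gcd (den ` vertices S) = 1"

text \<open>
  The library's \<^const>\<open>triangulation\<close> does not require closure under faces, hence the use of
  \<^const>\<open>simplicial_complex\<close>, in which complexes are finite.
\<close>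

definition rational_triangulation_of :: "(real ^ 'n) set set \<Rightarrow> (real ^ 'n) set \<Rightarrow> bool" where
  "rational_triangulation_of \<T> P \<longleftrightarrow>
    simplicial_complex \<T> \<and> \<Union>\<T> = P \<and> (\<forall>S \<in> \<T>. rational_simplex S)"

text \<open>
  The empty polyhedron is triangulated by the complex without any simplexes. The complex consisting
  of the empty simplex alone is not strongly regular, as its gcd of denominators is 0.
\<close>

definition strongly_regular_triangulation_of ::
    "(real ^ 'n) set set \<Rightarrow> (real ^ 'n) set \<Rightarrow> bool" where
  "strongly_regular_triangulation_of \<T> P \<longleftrightarrow>
    rational_triangulation_of \<T> P \<and>
    (\<forall>S \<in> \<T>. (\<forall>S' \<in> \<T>. S \<subseteq> S' \<longrightarrow> S' = S) \<longrightarrow> strongly_regular_simplex S)"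

end

theory Submission
  imports Defs
begin

text \<open>
  Regular triangulations are constructed as fans in \<open>\<int>\<^sup>n\<^sup>+\<^sup>1\<close>: a regular simplex with vertices
  \<open>v\<^sub>i\<close> is the slice at height 1 of the cone generated by part of an integral basis. Start with
  the complete fan of all orthants. For an integral functional \<open>g\<close>, repeatedly insert the mediant
  \<open>v + w\<close> of an edge with \<open>g v > 0 > g w\<close>, always choosing \<open>g v - g w\<close> maximal. Mediants preserve
  regularity, and the process stops because every new crossing edge has a smaller gap. Doing this for
  the finitely many functionals bounding the simplexes of \<open>P\<close> yields a fan in which the cone over
  \<open>P\<close> is a union of cones.

  In a regular triangulation, a maximal simplex \<open>S\<close> is strongly regular iff its affine hull contains an
  integer point: if \<open>\<Sum>u\<^sub>i v\<^sub>i\<close> with \<open>\<Sum>u\<^sub>i = 1\<close> is integral, then every \<open>u\<^sub>i\<close> is a multiple of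
  \<open>den v\<^sub>i\<close>, so the denominators are coprime. Condition (ii) at the barycenter of \<open>S\<close> provides such a
  point. Conversely, a Bezout relation between the denominators of a strongly regular simplex
  provides an integer point of its affine hull, which can be moved into the cone of \<open>S\<close> at \<open>v\<close>.
\<close>

section \<open>Integral vectors and bases\<close>

definition rvec :: "int ^ 'm \<Rightarrow> real ^ 'm" where
  "rvec v = (\<chi> i. real_of_int (v $ i))"

lemma rvec_nth [simp]: "rvec v $ i = real_of_int (v $ i)"
  by (simp add: rvec_def)

lemma rvec_add [simp]: "rvec (v + w) = rvec v + rvec w"
  by (simp add: vec_eq_iff)

lemma rvec_minus [simp]: "rvec (- v) = - rvec v"
  by (simp add: vec_eq_iff)

lemma rvec_zero [simp]: "rvec 0 = 0"
  by (simp add: vec_eq_iff)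

lemma rvec_eq_iff [simp]: "rvec v = rvec w \<longleftrightarrow> v = w"
  by (simp add: vec_eq_iff)

definition pairing :: "int ^ 'm \<Rightarrow> int ^ 'm \<Rightarrow> int" where
  "pairing g v = (\<Sum>i\<in>UNIV. g $ i * v $ i)"

lemma inner_rvec [simp]: "rvec g \<bullet> rvec v = real_of_int (pairing g v)"
  by (simp add: pairing_def inner_vec_def)

lemma pairing_add: "pairing g (v + w) = pairing g v + pairing g w"
  by (simp add: pairing_def distrib_left sum.distrib)

text \<open>The coordinate at \<open>b\<close> is an additive integral function, so it is pairing
  with the vector of its values at the standard basis vectors.\<close>

lemma int_basis_dual:
  fixes B :: "(int ^ 'm) set"
  assumes "int_basis B" "b \<in> B"
  obtains \<phi> where "\<And>b'. b' \<in> B \<Longrightarrow> pairing \<phi> b' = (if b' = b then 1 else 0)"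
proof
  have B: "int_vec.independent B" "x \<in> int_vec.span B" for x
    using assms by (auto simp: int_basis_def)
  define \<phi> :: "int ^ 'm" where "\<phi> = (\<chi> i. int_vec.representation B (axis i 1) b)"
  show "pairing \<phi> b' = (if b' = b then 1 else 0)" if "b' \<in> B" for b'
  proof -
    have "pairing \<phi> b' = int_vec.representation B (\<Sum>i\<in>UNIV. b' $ i *s axis i 1) b"
      using B by (simp add: \<phi>_def pairing_def int_vec.representation_sum int_vec.representation_scale
          int_vec.span_scale mult.commute)
    also have "\<dots> = int_vec.representation B b' b"
      by (simp only: basis_expansion)
    also have "\<dots> = (if b' = b then 1 else 0)"
      using B that by (simp add: int_vec.representation_basis)
    finally show ?thesis .
  qed
qed

text \<open>The new set is the image of \<open>B\<close> under the shear
  \<open>x + pairing \<phi> x *s v\<close>, where \<open>\<phi>\<close> is the coordinate at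
  \<open>w\<close>. Since \<open>\<phi>\<close> vanishes at \<open>v\<close>, the shear preserves
  \<open>\<phi>\<close> and is inverted by subtracting the same multiple of
  \<open>v\<close>.\<close>

lemma int_basis_mediant:
  fixes B :: "(int ^ 'm) set"
  assumes B: "int_basis B" and vw: "v \<in> B" "w \<in> B" "v \<noteq> w"
  shows "int_basis (insert (v + w) (B - {w}))"
proof -
  obtain \<phi> where \<phi>: "\<And>b'. b' \<in> B \<Longrightarrow> pairing \<phi> b' = (if b' = w then 1 else 0)"
    using int_basis_dual[OF B vw(2)] by metis
  have lin: "pairing \<phi> (x + y) = pairing \<phi> x + pairing \<phi> y" "pairing \<phi> (k *s x) = k * pairing \<phi> x" for x y k
    by (simp_all add: pairing_def distrib_left sum.distrib sum_distrib_left mult.left_commute)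
  define f where "f x = x + pairing \<phi> x *s v" for x
  interpret f: module_hom "(*s) :: int \<Rightarrow> int ^ 'm \<Rightarrow> int ^ 'm" "(*s) :: int \<Rightarrow> int ^ 'm \<Rightarrow> int ^ 'm" f
    by unfold_locales
      (simp_all add: f_def lin vector_add_ldistrib vector_sadd_rdistrib vector_smult_assoc)
  have f_inv: "f (x + (- pairing \<phi> x) *s v) = x" for x
  proof -
    have "pairing \<phi> (x + (- pairing \<phi> x) *s v) = pairing \<phi> x"
      using \<phi>[OF vw(1)] vw(3) by (simp only: lin) simp
    then show ?thesis
      by (simp add: f_def vec_eq_iff)
  qed
  have "x = y" if "f x = f y" for x y
  proof -
    have "pairing \<phi> (f z) = pairing \<phi> z" for z
      using \<phi>[OF vw(1)] vw(3) by (simp add: f_def lin)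
    with that have "pairing \<phi> x = pairing \<phi> y"
      by metis
    with that show ?thesis
      by (simp add: f_def)
  qed
  then have inj: "inj_on f X" for X
    by (auto intro: inj_onI)
  have "f b = b" if "b \<in> B - {w}" for b
    using that \<phi> by (simp add: f_def)
  then have "f ` (B - {w}) = B - {w}"
    by simp
  moreover have "f w = v + w"
    using \<phi> vw by (simp add: f_def add.commute)
  ultimately have "f ` B = insert (v + w) (B - {w})"
    using vw by (metis image_insert insert_Diff)
  moreover have "int_vec.independent (f ` B)"
    using B inj by (intro f.independent_injective_image) (auto simp: int_basis_def)
  moreover have "int_vec.span (f ` B) = UNIV"
    using B f_inv by (simp add: f.span_image int_basis_def surj_def) metis
  ultimately show ?thesis
    by (simp add: int_basis_def)
qed

lemma int_basis_signed_axes: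
  fixes s :: "'m::finite \<Rightarrow> int"
  assumes s: "\<And>j. s j * s j = 1"
  shows "int_basis (range (\<lambda>j. axis j (s j)))"
proof -
  have "x \<in> int_vec.span (range (\<lambda>j. axis j (s j)))" for x :: "int ^ 'm"
  proof -
    have "x = (\<Sum>j\<in>UNIV. (x $ j * s j) *s axis j (s j))"
      using s by (simp add: vec_eq_iff axis_def sum.delta mult.assoc if_distrib cong: if_cong)
    also have "\<dots> \<in> int_vec.span (range (\<lambda>j. axis j (s j)))"
      by (intro int_vec.span_sum int_vec.span_scale int_vec.span_base) auto
    finally show ?thesis .
  qed
  moreover have "int_vec.independent (range (\<lambda>j. axis j (s j)))"
    unfolding int_vec.independent_explicit_module
  proof (intro allI impI)
    fix t u and v :: "int ^ 'm"
    assume t: "finite t" "t \<subseteq> range (\<lambda>j. axis j (s j))" "(\<Sum>v\<in>t. u v *s v) = 0" "v \<in> t"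
    then obtain j where j: "v = axis j (s j)"
      by blast
    have "0 = (\<Sum>x\<in>t. u x *s x) $ j"
      by (simp add: t)
    also have "\<dots> = (\<Sum>x\<in>t. if x = v then u v * s j else 0)"
      unfolding sum_component
    proof (intro sum.cong refl)
      fix x assume "x \<in> t"
      then obtain i where i: "x = axis i (s i)"
        using t by blast
      have "s j \<noteq> 0"
        using s[of j] by auto
      then have "x = v \<longleftrightarrow> i = j"
        using i j by (auto simp: axis_eq_axis)
      then show "(u x *s x) $ j = (if x = v then u v * s j else 0)"
        using i j by (auto simp: axis_def)
    qed
    also have "\<dots> = u v * s j"
      using t by simp
    finally show "u v = 0"
      using s[of j] by auto
  qed
  ultimately show ?thesis
    by (auto simp: int_basis_def)
qed

section \<open>Regular fans\<close>

text \<open>The support itself has to be a cone. In a regular fan it is then the unique cone with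
  the combined point in its relative interior, called its carrier below.\<close>

definition weights :: "(int ^ 'm) set set \<Rightarrow> (int ^ 'm \<Rightarrow> real) set" where
  "weights K = {c. (\<forall>v. 0 \<le> c v) \<and> {v. c v \<noteq> 0} \<in> K}"

text \<open>Summing over the support avoids naming a cone. An infinite support would give the value
  0, hence the finiteness assumptions below.\<close>

definition combine :: "(int ^ 'm \<Rightarrow> real) \<Rightarrow> real ^ 'm" where
  "combine c = (\<Sum>v | c v \<noteq> 0. c v *\<^sub>R rvec v)"

text \<open>
  A cone is represented by its set of generators. Injectivity of \<^const>\<open>combine\<close> says at once that
  each cone is simplicial and that two cones meet exactly in the cone on their common generators.
\<close>

definition regular_fan :: "(int ^ 'm) set set \<Rightarrow> bool" where
  "regular_fan K \<longleftrightarrow> finite K \<and> {} \<in> K \<and> (\<forall>\<sigma>\<in>K. finite \<sigma>) \<and> (\<forall>\<sigma>\<in>K. \<forall>\<tau>. \<tau> \<subseteq> \<sigma> \<longrightarrow> \<tau> \<in> K) \<and>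
    (\<forall>\<sigma>\<in>K. \<exists>B. int_basis B \<and> \<sigma> \<subseteq> B) \<and> inj_on combine (weights K)"

definition non_crossing :: "int ^ 'm \<Rightarrow> (int ^ 'm) set set \<Rightarrow> bool" where
  "non_crossing g K \<longleftrightarrow> (\<forall>\<sigma>\<in>K. (\<forall>v\<in>\<sigma>. 0 \<le> pairing g v) \<or> (\<forall>v\<in>\<sigma>. pairing g v \<le> 0))"

text \<open>The stellar subdivision at the mediant: cones containing the edge disappear, and
  \<open>v + w\<close> is joined to those of their faces that do not contain the edge.\<close>

definition subdivide :: "int ^ 'm \<Rightarrow> int ^ 'm \<Rightarrow> (int ^ 'm) set set \<Rightarrow> (int ^ 'm) set set" where
  "subdivide v w K = {\<sigma> \<in> K. \<not> {v, w} \<subseteq> \<sigma>} \<union>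
    insert (v + w) ` {\<tau> \<in> K. \<not> {v, w} \<subseteq> \<tau> \<and> \<tau> \<union> {v, w} \<in> K}"

lemma combine_eq_sum:
  assumes "finite S" "{v. c v \<noteq> 0} \<subseteq> S"
  shows "combine c = (\<Sum>v\<in>S. c v *\<^sub>R rvec v)"
  unfolding combine_def using assms by (intro sum.mono_neutral_left) auto

lemma combine_add:
  assumes "finite {v. c v \<noteq> 0}" "finite {v. d v \<noteq> 0}"
  shows "combine (\<lambda>v. c v + d v) = combine c + combine d"
proof -
  let ?S = "{v. c v \<noteq> 0} \<union> {v. d v \<noteq> 0}"
  have "combine (\<lambda>v. c v + d v) = (\<Sum>v\<in>?S. (c v + d v) *\<^sub>R rvec v)"
    "combine c = (\<Sum>v\<in>?S. c v *\<^sub>R rvec v)" "combine d = (\<Sum>v\<in>?S. d v *\<^sub>R rvec v)"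
    by (rule combine_eq_sum; use assms in force)+
  then show ?thesis
    by (simp add: scaleR_left_distrib sum.distrib)
qed

lemma combine_single: "combine (\<lambda>x. if x = v then a else 0) = a *\<^sub>R rvec v"
  by (subst combine_eq_sum[of "{v}"]) auto

lemma regular_fanD:
  assumes "regular_fan K"
  shows "finite K" "{} \<in> K" "\<And>\<sigma>. \<sigma> \<in> K \<Longrightarrow> finite \<sigma>" "\<And>\<sigma> \<tau>. \<lbrakk>\<sigma> \<in> K; \<tau> \<subseteq> \<sigma>\<rbrakk> \<Longrightarrow> \<tau> \<in> K"
    "\<And>\<sigma>. \<sigma> \<in> K \<Longrightarrow> \<exists>B. int_basis B \<and> \<sigma> \<subseteq> B" "inj_on combine (weights K)"
  using assms unfolding regular_fan_def by blast+

lemma weightsD: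
  assumes "c \<in> weights K"
  shows "0 \<le> c v" "{v. c v \<noteq> 0} \<in> K"
  using assms by (auto simp: weights_def)

text \<open>Otherwise the vector \<open>v + w\<close> would be represented twice, by weight 1 on
  itself and by weight 1 on each of \<open>v\<close> and \<open>w\<close>, against injectivity of
  \<open>combine\<close>.\<close>

lemma mediant_notin_fan:
  assumes K: "regular_fan K" and vw: "{v, w} \<in> K" "v \<noteq> w" and \<sigma>: "\<sigma> \<in> K"
  shows "v + w \<notin> \<sigma>"
proof
  assume "v + w \<in> \<sigma>"
  let ?c = "\<lambda>x. if x = v + w then 1 else 0 :: real"
  let ?d = "\<lambda>x. (if x = v then 1 else 0) + (if x = w then 1 else 0) :: real"
  have c: "{x. ?c x \<noteq> 0} = {v + w}" and d: "{x. ?d x \<noteq> 0} = {v, w}"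
    by auto
  have "?c \<in> weights K"
    using regular_fanD(4)[OF K \<sigma>, of "{v + w}"] \<open>v + w \<in> \<sigma>\<close> unfolding weights_def mem_Collect_eq c by auto
  moreover have "?d \<in> weights K"
    using vw unfolding weights_def mem_Collect_eq d by auto
  moreover have "combine ?c = combine ?d"
    by (subst combine_add) (auto simp: combine_single)
  ultimately have "?c = ?d"
    using regular_fanD(6)[OF K] by (metis (mono_tags, lifting) inj_onD)
  then have "{x. ?c x \<noteq> 0} = {x. ?d x \<noteq> 0}"
    by (rule arg_cong[where f = "\<lambda>c. {x. c x \<noteq> 0}"])
  then have "{v + w} = {v, w}"
    unfolding c d .
  then show False
    using vw(2) by auto
qed

text \<open>
  Rewrites a weight on \<open>v + w\<close> as weights on \<open>v\<close> and \<open>w\<close>. This is a bijection from the weights of the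
  subdivided fan to those of the original one, with \<open>min (c v) (c w)\<close> becoming the weight of \<open>v + w\<close>
  in the inverse direction.
\<close>

definition push :: "int ^ 'm \<Rightarrow> int ^ 'm \<Rightarrow> (int ^ 'm \<Rightarrow> real) \<Rightarrow> int ^ 'm \<Rightarrow> real" where
  "push v w c x = c x + (if x = v then c (v + w) else 0) + (if x = w then c (v + w) else 0)
     + (if x = v + w then - c (v + w) else 0)"

lemma combine_push:
  assumes "finite {x. c x \<noteq> 0}"
  shows "combine (push v w c) = combine c"
proof -
  have single: "finite {x. (if x = y then a else 0) \<noteq> (0::real)}" for a and y :: "int ^ 'm"
    by (rule finite_subset[of _ "{y}"]) auto
  have add: "finite {x. c x + d x \<noteq> 0}" if "finite {x. c x \<noteq> 0}" "finite {x. d x \<noteq> 0}"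
    for c d :: "int ^ 'm \<Rightarrow> real"
    by (rule finite_subset[of _ "{x. c x \<noteq> 0} \<union> {x. d x \<noteq> 0}"]) (use that in auto)
  have "push v w c = (\<lambda>x. c x + (if x = v then c (v + w) else 0) + (if x = w then c (v + w) else 0)
     + (if x = v + w then - c (v + w) else 0))"
    by (simp add: push_def fun_eq_iff)
  then have "combine (push v w c) = combine c + c (v + w) *\<^sub>R rvec v + c (v + w) *\<^sub>R rvec w
     + (- c (v + w)) *\<^sub>R rvec (v + w)"
    using assms by (simp only: combine_add combine_single single add)
  then show ?thesis
    by (simp add: algebra_simps)
qed

section \<open>Mediant subdivision preserves regularity, the covered set and non-crossing
  functionals\<close>

context
  fixes K :: "(int ^ 'm) set set" and v w :: "int ^ 'm"
  assumes K: "regular_fan K" and vw: "{v, w} \<in> K" "v \<noteq> w"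
begin

lemma mediant_distinct: "v + w \<noteq> v" "v + w \<noteq> w"
  using mediant_notin_fan[OF K vw vw(1)] by auto

lemma edge_notin_subdivide:
  assumes "\<sigma> \<in> subdivide v w K"
  shows "\<not> {v, w} \<subseteq> \<sigma>"
  using assms unfolding subdivide_def
proof
  assume "\<sigma> \<in> insert (v + w) ` {\<tau> \<in> K. \<not> {v, w} \<subseteq> \<tau> \<and> \<tau> \<union> {v, w} \<in> K}"
  then obtain \<tau> where "\<sigma> = insert (v + w) \<tau>" "\<not> {v, w} \<subseteq> \<tau>"
    by blast
  then show ?thesis
    using mediant_distinct by (metis insert_subset insert_iff empty_subsetI)
qed blast

text \<open>The support is an old cone or \<open>v + w\<close> joined to an old cone. In the second
  case deleting \<open>v + w\<close> recovers the old cone, because no cone of \<open>K\<close>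
  contains the mediant.\<close>

lemma weights_subdivide_cases:
  assumes c: "c \<in> weights (subdivide v w K)"
  shows "c v = 0 \<or> c w = 0"
    and "c (v + w) = 0 \<Longrightarrow> {x. c x \<noteq> 0} \<in> K"
    and "c (v + w) \<noteq> 0 \<Longrightarrow> {x. c x \<noteq> 0} - {v + w} \<union> {v, w} \<in> K"
proof -
  let ?s = "{x. c x \<noteq> 0}"
  have s: "?s \<in> subdivide v w K"
    using weightsD(2)[OF c] .
  then have "\<not> {v, w} \<subseteq> ?s"
    by (rule edge_notin_subdivide)
  then show "c v = 0 \<or> c w = 0"
    by simp
  show "?s \<in> K" if "c (v + w) = 0"
    using s that by (auto simp: subdivide_def)
  show "?s - {v + w} \<union> {v, w} \<in> K" if "c (v + w) \<noteq> 0"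
  proof -
    have "?s \<notin> K"
      using mediant_notin_fan[OF K vw, of ?s] that by blast
    then obtain \<tau> where "\<tau> \<in> K" "?s = insert (v + w) \<tau>" "\<tau> \<union> {v, w} \<in> K"
      using s by (auto simp: subdivide_def)
    moreover have "v + w \<notin> \<tau>"
      using mediant_notin_fan[OF K vw] \<open>\<tau> \<in> K\<close> by blast
    ultimately show ?thesis
      by simp
  qed
qed

lemma finite_weights_subdivide:
  assumes c: "c \<in> weights (subdivide v w K)"
  shows "finite {x. c x \<noteq> 0}"
proof -
  have "\<forall>\<sigma>\<in>subdivide v w K. finite \<sigma>"
    using regular_fanD(3)[OF K] by (auto simp: subdivide_def)
  then show ?thesis
    using weightsD(2)[OF c] by blast
qed

lemma push_weights:
  assumes c: "c \<in> weights (subdivide v w K)"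
  shows "push v w c \<in> weights K"
proof -
  have pos: "0 \<le> c x" for x
    using weightsD(1)[OF c] .
  have "{x. push v w c x \<noteq> 0} \<in> K"
  proof (cases "c (v + w) = 0")
    case True
    have "push v w c = c"
      by (rule ext) (simp only: push_def True minus_zero if_cancel add_0_right)
    then show ?thesis
      using weights_subdivide_cases(2)[OF c True] by simp
  next
    case False
    then have "c (v + w) > 0"
      using pos[of "v + w"] by linarith
    \<comment> \<open>Nonnegative weights cannot cancel, so pushing removes exactly
      \<open>v + w\<close> from the support and adds both ends of the edge.\<close>
    then have "push v w c x \<noteq> 0 \<longleftrightarrow> x \<noteq> v + w \<and> (c x \<noteq> 0 \<or> x = v \<or> x = w)" for x
      using mediant_distinct pos[of x] by (auto simp: push_def)
    then have "{x. push v w c x \<noteq> 0} = {x. x \<noteq> v + w \<and> (c x \<noteq> 0 \<or> x = v \<or> x = w)}"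
      by (rule Collect_cong)
    also have "\<dots> = {x. c x \<noteq> 0} - {v + w} \<union> {v, w}"
      using mediant_distinct by blast
    finally have "{x. push v w c x \<noteq> 0} = {x. c x \<noteq> 0} - {v + w} \<union> {v, w}" .
    then show ?thesis
      using weights_subdivide_cases(3)[OF c False] by simp
  qed
  then show ?thesis
    using pos mediant_distinct by (auto simp: weights_def push_def)
qed

lemma inj_on_push: "inj_on (push v w) (weights (subdivide v w K))"
proof (intro inj_onI ext)
  fix c d x
  assume cd: "c \<in> weights (subdivide v w K)" "d \<in> weights (subdivide v w K)" "push v w c = push v w d"
  \<comment> \<open>One of \<open>e v\<close> and \<open>e w\<close> is 0, since no cone of the
    subdivision contains the edge. The smaller pushed weight is therefore exactly what
    \<open>v + w\<close> contributed.\<close>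
  have min: "e (v + w) = min (push v w e v) (push v w e w)" if "e \<in> weights (subdivide v w K)" for e
    using weights_subdivide_cases(1)[OF that] weightsD(1)[OF that, of v] weightsD(1)[OF that, of w]
      mediant_distinct vw(2)
    by (auto simp: push_def min_def)
  have eq: "c (v + w) = d (v + w)"
    unfolding min[OF cd(1)] min[OF cd(2)] cd(3) ..
  show "c x = d x"
    using fun_cong[OF cd(3), of x] unfolding push_def eq by linarith
qed

lemma push_surj:
  assumes c: "c \<in> weights K"
  shows "\<exists>d \<in> weights (subdivide v w K). push v w d = c"
proof -
  \<comment> \<open>The largest amount that can be taken from both ends of the edge and given to the
    mediant; it empties at least one end.\<close>
  define m where "m = min (c v) (c w)"
  define d where "d x = (if x = v + w then m else if x = v \<or> x = w then c x - m else c x)" for x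
  have u: "c (v + w) = 0"
    using mediant_notin_fan[OF K vw weightsD(2)[OF c]] by simp
  have pos: "0 \<le> c x" for x
    using weightsD(1)[OF c] .
  have "push v w d = c"
    using mediant_distinct u vw(2) by (auto simp: push_def d_def fun_eq_iff)
  moreover have "{x. d x \<noteq> 0} \<in> subdivide v w K"
  proof (cases "m = 0")
    case True
    then have "d = c"
      using u by (auto simp: d_def fun_eq_iff)
    moreover have "\<not> {v, w} \<subseteq> {x. c x \<noteq> 0}"
      using True by (auto simp: m_def min_def split: if_splits)
    ultimately show ?thesis
      unfolding subdivide_def using weightsD(2)[OF c] by blast
  next
    case False
    then have m: "m > 0" "c v > 0" "c w > 0"
      using pos[of v] pos[of w] by (auto simp: m_def)
    let ?t = "{x. d x \<noteq> 0} - {v + w}"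
    have "?t \<subseteq> {x. c x \<noteq> 0}" "?t \<union> {v, w} = {x. c x \<noteq> 0}"
      using m u mediant_distinct by (auto simp: d_def split: if_splits)
    then have "?t \<in> K" "?t \<union> {v, w} \<in> K"
      using weightsD(2)[OF c] regular_fanD(4)[OF K] by auto
    moreover have "\<not> {v, w} \<subseteq> ?t"
      using mediant_distinct by (auto simp: d_def m_def min_def)
    moreover have "{x. d x \<noteq> 0} = insert (v + w) ?t"
      using m by (auto simp: d_def)
    ultimately show ?thesis
      unfolding subdivide_def by blast
  qed
  moreover have "0 \<le> d x" for x
    using pos by (auto simp: d_def m_def)
  ultimately show ?thesis
    unfolding weights_def by blast
qed

lemma combine_weights_subdivide: "combine ` weights (subdivide v w K) = combine ` weights K"
proof
  show "combine ` weights (subdivide v w K) \<subseteq> combine ` weights K"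
  proof
    fix x assume "x \<in> combine ` weights (subdivide v w K)"
    then obtain c where c: "c \<in> weights (subdivide v w K)" "x = combine c" by blast
    then show "x \<in> combine ` weights K"
      using push_weights combine_push[OF finite_weights_subdivide] by (metis imageI)
  qed
  show "combine ` weights K \<subseteq> combine ` weights (subdivide v w K)"
  proof
    fix x assume "x \<in> combine ` weights K"
    then obtain c where c: "c \<in> weights K" "x = combine c" by blast
    then obtain d where "d \<in> weights (subdivide v w K)" "push v w d = c"
      using push_surj by blast
    then show "x \<in> combine ` weights (subdivide v w K)"
      using c combine_push[OF finite_weights_subdivide] by (metis imageI)
  qed
qed

lemma regular_fan_subdivide: "regular_fan (subdivide v w K)"
  unfolding regular_fan_def
proof (intro conjI ballI allI impI)
  show "finite (subdivide v w K)"
    using regular_fanD(1)[OF K] by (simp add: subdivide_def)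
  show "{} \<in> subdivide v w K"
    using regular_fanD(2)[OF K] by (simp add: subdivide_def)
  show "inj_on combine (weights (subdivide v w K))"
  proof (rule inj_onI)
    fix c d
    assume cd: "c \<in> weights (subdivide v w K)" "d \<in> weights (subdivide v w K)" "combine c = combine d"
    then have "combine (push v w c) = combine (push v w d)"
      using combine_push finite_weights_subdivide by metis
    then show "c = d"
      using cd push_weights inj_onD[OF regular_fanD(6)[OF K]] inj_onD[OF inj_on_push] by metis
  qed
next
  fix \<sigma> assume "\<sigma> \<in> subdivide v w K"
  then show "finite \<sigma>"
    using regular_fanD(3)[OF K] by (auto simp: subdivide_def)
next
  fix \<sigma> \<tau> assume \<sigma>: "\<sigma> \<in> subdivide v w K" and \<tau>: "\<tau> \<subseteq> \<sigma>"
  show "\<tau> \<in> subdivide v w K"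
  proof (cases "\<sigma> \<in> K \<and> \<not> {v, w} \<subseteq> \<sigma>")
    case True
    then show ?thesis
      using \<tau> regular_fanD(4)[OF K] by (auto simp: subdivide_def)
  next
    case False
    then obtain \<rho> where \<rho>: "\<rho> \<in> K" "\<sigma> = insert (v + w) \<rho>" "\<not> {v, w} \<subseteq> \<rho>" "\<rho> \<union> {v, w} \<in> K"
      using \<sigma> by (auto simp: subdivide_def)
    show ?thesis
    proof (cases "v + w \<in> \<tau>")
      case True
      have sub: "\<tau> - {v + w} \<subseteq> \<rho>"
        using \<tau> \<rho> by auto
      then have "\<tau> - {v + w} \<in> K" "\<tau> - {v + w} \<union> {v, w} \<in> K"
        using regular_fanD(4)[OF K \<rho>(1) sub] regular_fanD(4)[OF K \<rho>(4), of "\<tau> - {v + w} \<union> {v, w}"]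
        by blast+
      moreover have "\<not> {v, w} \<subseteq> \<tau> - {v + w}"
        using sub \<rho>(3) by blast
      moreover have "\<tau> = insert (v + w) (\<tau> - {v + w})"
        using True by auto
      ultimately show ?thesis
        unfolding subdivide_def by blast
    next
      case False
      then have "\<tau> \<subseteq> \<rho>"
        using \<tau> \<rho> by auto
      then show ?thesis
        using \<rho>(1,3) regular_fanD(4)[OF K] by (auto simp: subdivide_def)
    qed
  qed
next
  fix \<sigma> assume "\<sigma> \<in> subdivide v w K"
  then consider "\<sigma> \<in> K" | \<tau> where "\<sigma> = insert (v + w) \<tau>" "\<not> {v, w} \<subseteq> \<tau>" "\<tau> \<union> {v, w} \<in> K"
    by (auto simp: subdivide_def)
  then show "\<exists>B. int_basis B \<and> \<sigma> \<subseteq> B"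
  proof cases
    case 1
    then show ?thesis
      using regular_fanD(5)[OF K] by blast
  next
    case 2
    then obtain B where B: "int_basis B" "\<tau> \<union> {v, w} \<subseteq> B"
      using regular_fanD(5)[OF K] by blast
    \<comment> \<open>\<open>\<tau>\<close> misses one end of the edge, and that end is the basis
      vector which the mediant may replace. Both choices are prepared.\<close>
    then have "int_basis (insert (v + w) (B - {w}))" "int_basis (insert (v + w) (B - {v}))"
      using int_basis_mediant[of B v w] int_basis_mediant[of B w v] vw(2) by (auto simp: add.commute)
    then show ?thesis
      using 2(1,2) B(2) by blast
  qed
qed

text \<open>This allows several functionals to be treated one after another: a half-space containing
  both ends of the edge contains the mediant.\<close>

lemma non_crossing_subdivide:
  assumes "non_crossing g K"
  shows "non_crossing g (subdivide v w K)"
  unfolding non_crossing_def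
proof
  fix \<sigma> assume "\<sigma> \<in> subdivide v w K"
  then consider "\<sigma> \<in> K" | \<tau> where "\<sigma> = insert (v + w) \<tau>" "\<tau> \<union> {v, w} \<in> K"
    by (auto simp: subdivide_def)
  then show "(\<forall>v\<in>\<sigma>. 0 \<le> pairing g v) \<or> (\<forall>v\<in>\<sigma>. pairing g v \<le> 0)"
  proof cases
    case 1
    then show ?thesis
      using assms by (simp add: non_crossing_def)
  next
    case 2
    have "(\<forall>x\<in>\<tau> \<union> {v, w}. 0 \<le> pairing g x) \<or> (\<forall>x\<in>\<tau> \<union> {v, w}. pairing g x \<le> 0)"
      using bspec[OF assms[unfolded non_crossing_def] 2(2)] .
    then show ?thesis
      unfolding 2(1) by (elim disjE) (auto simp: pairing_add)
  qed
qed

end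

section \<open>Termination of the removal of crossing edges\<close>

definition crossings :: "int ^ 'm \<Rightarrow> (int ^ 'm) set set \<Rightarrow> ((int ^ 'm) \<times> (int ^ 'm)) set" where
  "crossings g K = {(v, w). {v, w} \<in> K \<and> pairing g v > 0 \<and> pairing g w < 0}"

lemma finite_crossings:
  assumes "regular_fan K"
  shows "finite (crossings g K)"
proof (rule finite_subset)
  show "crossings g K \<subseteq> \<Union>K \<times> \<Union>K"
    by (auto simp: crossings_def)
  show "finite (\<Union>K \<times> \<Union>K)"
    using regular_fanD(1,3)[OF assms] by blast
qed

lemma non_crossing_iff:
  assumes "regular_fan K"
  shows "non_crossing g K \<longleftrightarrow> crossings g K = {}"
proof
  assume "non_crossing g K"
  then show "crossings g K = {}"
    by (force simp: non_crossing_def crossings_def)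
next
  assume *: "crossings g K = {}"
  show "non_crossing g K"
    unfolding non_crossing_def
  proof (rule ballI, rule ccontr)
    fix \<sigma> assume "\<sigma> \<in> K" "\<not> ((\<forall>v\<in>\<sigma>. 0 \<le> pairing g v) \<or> (\<forall>v\<in>\<sigma>. pairing g v \<le> 0))"
    then have "\<exists>v\<in>\<sigma>. pairing g v > 0" "\<exists>w\<in>\<sigma>. pairing g w < 0"
      by (simp_all add: not_le)
    then obtain v w where vw: "v \<in> \<sigma>" "w \<in> \<sigma>" "pairing g v > 0" "pairing g w < 0"
      by (elim bexE)
    have "{v, w} \<in> K"
      using vw \<open>\<sigma> \<in> K\<close> by (intro regular_fanD(4)[OF assms \<open>\<sigma> \<in> K\<close>]) simp
    then have "(v, w) \<in> crossings g K"
      using vw by (simp add: crossings_def)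
    then show False
      using * by simp
  qed
qed

definition gap :: "int ^ 'm \<Rightarrow> (int ^ 'm) \<times> (int ^ 'm) \<Rightarrow> int" where
  "gap g e = pairing g (fst e) - pairing g (snd e)"

text \<open>A new crossing edge joins \<open>v + w\<close> to some old generator. If the mediant is
  the positive end, replacing it by \<open>v\<close> gives an old crossing whose gap is larger by
  \<open>- pairing g w\<close>; if it is the negative end, \<open>w\<close> takes its place and the
  gap grows by \<open>pairing g v\<close>. So the new gap is below \<open>N\<close>.\<close>

lemma crossings_subdivide:
  assumes K: "regular_fan K" and vw: "(v, w) \<in> crossings g K"
    and max: "\<And>e. e \<in> crossings g K \<Longrightarrow> gap g e \<le> N"
    and e: "e \<in> crossings g (subdivide v w K)"
  shows "e \<in> crossings g K - {(v, w)} \<or> gap g e < N"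
proof -
  obtain a b where ab: "e = (a, b)" "{a, b} \<in> subdivide v w K" "pairing g a > 0" "pairing g b < 0"
    using e by (auto simp: crossings_def)
  have g: "pairing g v > 0" "pairing g w < 0"
    using vw by (auto simp: crossings_def)
  show ?thesis
  proof (cases "{a, b} \<in> K \<and> \<not> {v, w} \<subseteq> {a, b}")
    case True
    then show ?thesis
      using ab by (auto simp: crossings_def)
  next
    case False
    then obtain \<tau> where \<tau>: "{a, b} = insert (v + w) \<tau>" "\<tau> \<union> {v, w} \<in> K"
      using ab by (auto simp: subdivide_def)
    have "a \<noteq> b"
      using ab by auto
    have "v + w \<in> {a, b}"
      unfolding \<tau>(1) by simp
    moreover have "a \<in> insert (v + w) \<tau>" "b \<in> insert (v + w) \<tau>"
      unfolding \<tau>(1)[symmetric] by simp_all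
    ultimately consider "a = v + w" "b \<in> \<tau>" | "b = v + w" "a \<in> \<tau>"
      using \<open>a \<noteq> b\<close> by auto
    then show ?thesis
    proof cases
      case 1
      then have "{v, b} \<in> K"
        using regular_fanD(4)[OF K \<tau>(2)] by auto
      then have "gap g (v, b) \<le> N"
        using g ab by (intro max) (auto simp: crossings_def)
      then show ?thesis
        using 1 ab g by (simp add: gap_def pairing_add)
    next
      case 2
      then have "{a, w} \<in> K"
        using regular_fanD(4)[OF K \<tau>(2)] by auto
      then have "gap g (a, w) \<le> N"
        using g ab by (intro max) (auto simp: crossings_def)
      then show ?thesis
        using 2 ab g by (simp add: gap_def pairing_add)
    qed
  qed
qed

text \<open>Only the covered set and the functionals already resolved are recorded; the iteration
  needs no comparison cone by cone.\<close>

definition refines :: "(int ^ 'm) set set \<Rightarrow> (int ^ 'm) set set \<Rightarrow> bool" where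
  "refines K' K \<longleftrightarrow> regular_fan K' \<and> combine ` weights K' = combine ` weights K \<and>
    (\<forall>g. non_crossing g K \<longrightarrow> non_crossing g K')"

lemma refines_trans: "\<lbrakk>refines K'' K'; refines K' K\<rbrakk> \<Longrightarrow> refines K'' K"
  by (auto simp: refines_def)

lemma refines_subdivide:
  assumes "regular_fan K" "{v, w} \<in> K" "v \<noteq> w"
  shows "refines (subdivide v w K) K"
  using regular_fan_subdivide[OF assms] combine_weights_subdivide[OF assms] non_crossing_subdivide[OF assms]
  by (simp add: refines_def)

text \<open>The outer induction is on the bound for the gaps, the inner one on the number of
  crossings that attain it. Subdividing such a crossing removes it and creates only crossings of
  smaller gap.\<close>

lemma refinement_bounded_gap:
  assumes "regular_fan K" "\<And>e. e \<in> crossings g K \<Longrightarrow> gap g e \<le> int N"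
  shows "\<exists>K'. refines K' K \<and> non_crossing g K'"
  using assms
proof (induction N arbitrary: K)
  case 0
  \<comment> \<open>A crossing has gap at least 2, being a positive minus a negative
    integer.\<close>
  have "crossings g K = {}"
    using "0.prems"(2) by (fastforce simp: crossings_def gap_def)
  then show ?case
    using "0.prems"(1) non_crossing_iff by (auto simp: refines_def)
next
  case (Suc N)
  define M where "M L = {e \<in> crossings g L. gap g e = int (Suc N)}" for L
  from Suc.prems show ?case
  proof (induction "card (M K)" arbitrary: K rule: less_induct)
    case (less K)
    show ?case
    proof (cases "M K = {}")
      case True
      have "gap g e \<le> int N" if "e \<in> crossings g K" for e
      proof -
        have "gap g e \<noteq> int (Suc N)"
          using True that unfolding M_def by blast
        then show ?thesis
          using less.prems(2)[OF that] by simp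
      qed
      then show ?thesis
        using Suc.IH less.prems(1) by blast
    next
      case False
      then obtain v w where vw: "(v, w) \<in> M K"
        by auto
      then have cross: "(v, w) \<in> crossings g K" and "{v, w} \<in> K" "v \<noteq> w"
        by (auto simp: M_def crossings_def)
      let ?K = "subdivide v w K"
      have ref: "refines ?K K"
        using less.prems(1) \<open>{v, w} \<in> K\<close> \<open>v \<noteq> w\<close> by (rule refines_subdivide)
      have dich: "e \<in> crossings g K - {(v, w)} \<or> gap g e < int (Suc N)" if "e \<in> crossings g ?K" for e
        using crossings_subdivide[OF less.prems(1) cross less.prems(2) that] .
      have "M ?K \<subseteq> M K - {(v, w)}"
        using dich by (force simp: M_def)
      moreover have "finite (M K)"
        using finite_crossings[OF less.prems(1)] by (simp add: M_def)
      ultimately have "card (M ?K) < card (M K)"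
        using vw by (intro psubset_card_mono) auto
      moreover have "gap g e \<le> int (Suc N)" if "e \<in> crossings g ?K" for e
        using dich[OF that] less.prems(2)[of e] by auto
      ultimately obtain K' where "refines K' ?K" "non_crossing g K'"
        using less.hyps[of ?K] ref by (auto simp: refines_def)
      then show ?thesis
        using refines_trans ref by blast
    qed
  qed
qed

lemma refinement_non_crossing:
  assumes K: "regular_fan K"
  shows "\<exists>K'. refines K' K \<and> non_crossing g K'"
proof -
  \<comment> \<open>Inserting 0 makes the maximum meaningful in the absence of crossings.\<close>
  let ?N = "nat (Max (insert 0 (gap g ` crossings g K)))"
  have "gap g e \<le> int ?N" if "e \<in> crossings g K" for e
  proof -
    have "gap g e \<le> Max (insert 0 (gap g ` crossings g K))"
      using finite_crossings[OF K] that by (intro Max_ge) auto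
    then show ?thesis
      by linarith
  qed
  then show ?thesis
    using refinement_bounded_gap[OF K] by blast
qed

lemma refinement_non_crossing_finite:
  assumes "finite G" "regular_fan K"
  shows "\<exists>K'. refines K' K \<and> (\<forall>g\<in>G. non_crossing g K')"
  using assms
proof (induction G)
  case empty
  then show ?case
    by (auto simp: refines_def)
next
  case (insert g G)
  then obtain K' where "refines K' K" "\<forall>g\<in>G. non_crossing g K'"
    by blast
  moreover obtain K'' where "refines K'' K'" "non_crossing g K''"
    using refinement_non_crossing[of K' g] calculation by (auto simp: refines_def)
  ultimately show ?case
    using refines_trans by (auto simp: refines_def)
qed

section \<open>The orthant fan\<close>

definition orthant_fan :: "(int ^ 'm) set set" where
  "orthant_fan = {\<sigma>. \<exists>s. (\<forall>j. s j = 1 \<or> s j = -1) \<and> \<sigma> \<subseteq> range (\<lambda>j. axis j (s j))}"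

lemma axis_eq_axis_int [simp]: "axis i (a::int) = axis j b \<longleftrightarrow> i = j \<and> a = b \<or> a = 0 \<and> b = 0"
  by (auto simp: axis_eq_axis)

lemma axis_nth: "axis i a $ j = (if j = i then a else 0)"
  by (simp add: axis_def)

lemma orthant_fan_axes:
  assumes "\<sigma> \<in> orthant_fan"
  shows "\<sigma> \<subseteq> range (\<lambda>j. axis j 1) \<union> range (\<lambda>j. axis j (-1))"
    and "axis j 1 \<notin> \<sigma> \<or> axis j (-1) \<notin> \<sigma>"
proof -
  obtain s where s: "\<And>j. s j = 1 \<or> s j = -1" "\<sigma> \<subseteq> range (\<lambda>j. axis j (s j))"
    using assms by (auto simp: orthant_fan_def)
  have "axis j (s j) \<in> range (\<lambda>j. axis j 1) \<union> range (\<lambda>j. axis j (-1))" for j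
    using s(1)[of j] by (elim disjE) auto
  then show "\<sigma> \<subseteq> range (\<lambda>j. axis j 1) \<union> range (\<lambda>j. axis j (-1))"
    using s(2) by blast
  show "axis j 1 \<notin> \<sigma> \<or> axis j (-1) \<notin> \<sigma>"
  proof (rule ccontr)
    assume "\<not> ?thesis"
    then obtain i i' where "axis j 1 = axis i (s i)" "axis j (-1) = axis i' (s i')"
      using s(2) by blast
    then show False
      by simp
  qed
qed

lemma combine_orthant_weights:
  assumes c: "c \<in> weights orthant_fan"
  shows "combine c $ j = c (axis j 1) - c (axis j (-1))"
proof -
  let ?S = "range (\<lambda>j. axis j 1) \<union> range (\<lambda>j. axis j (-1)) :: (int ^ 'a) set"
  have "combine c = (\<Sum>v\<in>?S. c v *\<^sub>R rvec v)"
    using orthant_fan_axes(1)[OF weightsD(2)[OF c]] by (intro combine_eq_sum) auto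
  then have "combine c $ j = (\<Sum>v\<in>?S. c v * v $ j)"
    by simp
  also have "\<dots> = (\<Sum>v\<in>{axis j 1, axis j (-1)}. c v * v $ j)"
    by (intro sum.mono_neutral_right) (auto simp: axis_nth split: if_splits)
  also have "\<dots> = c (axis j 1) - c (axis j (-1))"
    by (simp add: axis_nth)
  finally show ?thesis .
qed

lemma regular_fan_orthant: "regular_fan orthant_fan"
  unfolding regular_fan_def
proof (intro conjI ballI allI impI)
  let ?S = "range (\<lambda>j. axis j 1) \<union> range (\<lambda>j. axis j (-1)) :: (int ^ 'a) set"
  have "orthant_fan \<subseteq> Pow ?S"
    using orthant_fan_axes(1) by blast
  then show "finite (orthant_fan :: (int ^ 'a) set set)"
    by (rule finite_subset) simp
  show "{} \<in> (orthant_fan :: (int ^ 'a) set set)"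
    by (auto simp: orthant_fan_def intro!: exI[of _ "\<lambda>_. 1"])
  show "inj_on combine (weights (orthant_fan :: (int ^ 'a) set set))"
  proof (intro inj_onI ext)
    fix c d :: "int ^ 'a \<Rightarrow> real" and x
    assume c: "c \<in> weights orthant_fan" and d: "d \<in> weights orthant_fan" and cd: "combine c = combine d"
    note axes = orthant_fan_axes[OF weightsD(2)]
    have eq: "c (axis j 1) - c (axis j (-1)) = d (axis j 1) - d (axis j (-1))" for j
      using combine_orthant_weights[OF c, of j] combine_orthant_weights[OF d, of j] cd by simp
    \<comment> \<open>At most one of the two opposite axis vectors carries weight, so the two
      weights are the positive and the negative part of their difference.\<close>
    have "c (axis j 1) = d (axis j 1) \<and> c (axis j (-1)) = d (axis j (-1))" for j
      using eq[of j] axes(2)[OF c, of j] axes(2)[OF d, of j] weightsD(1)[OF c, of "axis j 1"]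
        weightsD(1)[OF c, of "axis j (-1)"] weightsD(1)[OF d, of "axis j 1"] weightsD(1)[OF d, of "axis j (-1)"]
      by simp linarith
    moreover have "c x = 0 \<and> d x = 0" if "x \<notin> ?S"
      using that axes(1)[OF c] axes(1)[OF d] by blast
    ultimately show "c x = d x"
      by (cases "x \<in> ?S") auto
  qed
next
  fix \<sigma> :: "(int ^ 'a) set" assume "\<sigma> \<in> orthant_fan"
  then obtain s where s: "\<And>j. s j = 1 \<or> s j = -1" "\<sigma> \<subseteq> range (\<lambda>j. axis j (s j))"
    by (auto simp: orthant_fan_def)
  show "finite \<sigma>"
    by (rule finite_subset[OF s(2)]) simp
  have "s j * s j = 1" for j
    using s(1)[of j] by auto
  then show "\<exists>B. int_basis B \<and> \<sigma> \<subseteq> B"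
    using int_basis_signed_axes s(2) by blast
next
  fix \<sigma> \<tau> :: "(int ^ 'a) set" assume "\<sigma> \<in> orthant_fan" "\<tau> \<subseteq> \<sigma>"
  then show "\<tau> \<in> orthant_fan"
    unfolding orthant_fan_def by blast
qed

lemma combine_orthant_surj: "combine ` weights orthant_fan = UNIV"
proof -
  have "x \<in> combine ` weights orthant_fan" for x :: "real ^ 'a"
  proof -
    define s :: "'a \<Rightarrow> int" where "s j = (if x $ j < 0 then -1 else 1)" for j
    \<comment> \<open>Each axis vector pointing into the orthant of \<open>x\<close> receives the
      absolute value of that coordinate. The sum has at most one nonzero term, as these axis vectors
      are distinct.\<close>
    define c :: "int ^ 'a \<Rightarrow> real" where "c v = (\<Sum>j\<in>UNIV. if v = axis j (s j) then \<bar>x $ j\<bar> else 0)" for v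
    have s0: "s j \<noteq> 0" for j
      by (simp add: s_def)
    have c_axis: "c (axis j a) = (if a = s j then \<bar>x $ j\<bar> else 0)" for j a
    proof -
      have "c (axis j a) = (\<Sum>i\<in>UNIV. if i = j then if a = s j then \<bar>x $ j\<bar> else 0 else 0)"
        unfolding c_def using s0 by (intro sum.cong) auto
      then show ?thesis
        by simp
    qed
    have "{v. c v \<noteq> 0} \<subseteq> range (\<lambda>j. axis j (s j))"
    proof
      fix v assume "v \<in> {v. c v \<noteq> 0}"
      then have "(\<Sum>j\<in>UNIV. if v = axis j (s j) then \<bar>x $ j\<bar> else 0) \<noteq> 0"
        by (simp add: c_def)
      then obtain j where "(if v = axis j (s j) then \<bar>x $ j\<bar> else 0) \<noteq> 0"
        by (elim sum.not_neutral_contains_not_neutral)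
      then have "v = axis j (s j)"
        by (simp split: if_splits)
      then show "v \<in> range (\<lambda>j. axis j (s j))"
        by (rule range_eqI)
    qed
    moreover have "\<forall>j. s j = 1 \<or> s j = -1"
      by (simp add: s_def)
    ultimately have "{v. c v \<noteq> 0} \<in> orthant_fan"
      unfolding orthant_fan_def by blast
    moreover have "0 \<le> c v" for v
      unfolding c_def by (intro sum_nonneg) auto
    ultimately have c: "c \<in> weights orthant_fan"
      by (simp add: weights_def)
    have "combine c $ j = x $ j" for j
      using combine_orthant_weights[OF c, of j] by (simp add: c_axis s_def)
    then have "x = combine c"
      by (simp add: vec_eq_iff)
    then show ?thesis
      using c by (rule image_eqI)
  qed
  then show ?thesis
    by blast
qed

section \<open>Rational cones as intersections of half-spaces\<close>

text \<open>The product of the individual denominators works. The field is left general to cover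
  both rational functionals and real points.\<close>

lemma common_denominator:
  fixes f :: "'i::finite \<Rightarrow> 'a::field_char_0"
  assumes "\<And>i. f i \<in> \<rat>"
  shows "\<exists>N>0. \<forall>i. of_nat N * f i \<in> \<int>"
proof -
  have "\<exists>n>0. of_nat n * f i \<in> \<int>" for i
  proof -
    obtain a b :: int where ab: "b > 0" "f i = of_int a / of_int b"
      using assms[of i] by (elim Rats_cases') auto
    then have "of_nat (nat b) * f i = of_int a"
      by simp
    then show ?thesis
      using ab(1) by (intro exI[of _ "nat b"]) auto
  qed
  then obtain n where n: "\<And>i. n i > 0" "\<And>i. of_nat (n i) * f i \<in> \<int>"
    by metis
  have "of_nat (prod n UNIV) * f i = of_nat (prod n (UNIV - {i})) * (of_nat (n i) * f i)" for i
    by (simp add: prod.remove[of UNIV i] mult_ac)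
  then have "of_nat (prod n UNIV) * f i \<in> \<int>" for i
    using n(2) by (metis Ints_mult Ints_of_nat)
  moreover have "prod n UNIV > 0"
    using n(1) by (simp add: prod_pos)
  ultimately show ?thesis
    by blast
qed

text \<open>
  The basis extension takes place over the rationals because the dual functionals have to be
  integral after clearing denominators.
\<close>

lemma finite_cone_halfspaces:
  fixes W :: "(int ^ 'm) set"
  assumes fin: "finite W"
    and ind: "\<And>u. (\<Sum>w\<in>W. u w *\<^sub>R rvec w) = 0 \<Longrightarrow> \<forall>w\<in>W. u w = 0"
  obtains G :: "(int ^ 'm) set" where "finite G"
    "\<And>z. (\<forall>g\<in>G. 0 \<le> rvec g \<bullet> z) \<longleftrightarrow> (\<exists>a. (\<forall>w\<in>W. 0 \<le> a w) \<and> z = (\<Sum>w\<in>W. a w *\<^sub>R rvec w))"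
proof -
  define q :: "int ^ 'm \<Rightarrow> rat ^ 'm" where "q v = (\<chi> i. of_int (v $ i))" for v
  define r :: "rat ^ 'm \<Rightarrow> real ^ 'm" where "r v = (\<chi> i. of_rat (v $ i))" for v
  have q_nth: "q v $ i = of_int (v $ i)" for v i
    by (simp add: q_def)
  have rq: "r (q v) = rvec v" for v
    by (simp add: r_def q_def vec_eq_iff)
  have inj: "inj_on q W"
    by (auto simp: inj_on_def q_def vec_eq_iff)
  have "vec.independent (q ` W)"
  proof
    assume "vec.dependent (q ` W)"
    then obtain u where u: "\<exists>v\<in>q ` W. u v \<noteq> 0" "(\<Sum>v\<in>q ` W. u v *s v) = 0"
      using vec.dependent_finite[of "q ` W"] fin by auto
    have "(\<Sum>w\<in>W. of_rat (u (q w)) *\<^sub>R rvec w) $ i = 0" for i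
    proof -
      have "(\<Sum>w\<in>W. of_rat (u (q w)) *\<^sub>R rvec w) $ i = of_rat ((\<Sum>v\<in>q ` W. u v *s v) $ i)"
        by (simp add: sum.reindex[OF inj] of_rat_sum of_rat_mult q_nth)
      then show ?thesis
        by (simp add: u(2))
    qed
    then have "(\<Sum>w\<in>W. of_rat (u (q w)) *\<^sub>R rvec w) = 0"
      by (simp add: vec_eq_iff)
    then have "\<forall>w\<in>W. u (q w) = 0"
      using ind[of "\<lambda>w. of_rat (u (q w))"] by simp
    then show False
      using u(1) by blast
  qed
  then obtain B where B: "q ` W \<subseteq> B" "vec.independent B" "vec.span B = UNIV"
    using vec.extend_basis_superset vec.independent_extend_basis vec.span_extend_basis by metis
  have finB: "finite B"
    using B(2) by (rule vec.finiteI_independent)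
  \<comment> \<open>The coordinate functional of \<open>b\<close>, again as the vector of its values
    at the standard basis.\<close>
  define \<phi> where "\<phi> b = (\<chi> i. vec.representation B (axis i 1) b)" for b
  have dual: "(\<Sum>i\<in>UNIV. \<phi> b $ i * b' $ i) = (if b = b' then 1 else 0)" if "b' \<in> B" for b b'
  proof -
    have "(\<Sum>i\<in>UNIV. \<phi> b $ i * b' $ i) = vec.representation B (\<Sum>i\<in>UNIV. b' $ i *s axis i 1) b"
      using B by (simp add: \<phi>_def vec.representation_sum vec.representation_scale mult.commute)
    also have "\<dots> = vec.representation B b' b"
      by (simp only: basis_expansion)
    finally show ?thesis
      using B(2) that by (simp add: vec.representation_basis)
  qed
  \<comment> \<open>The companion of \<open>dual\<close>: the matrices of \<open>\<phi>\<close> and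
    of \<open>B\<close> are inverse to each other on this side as well. Both identities between
    rational entries survive in the reals, so \<open>\<phi>\<close> also gives the coordinates of
    real vectors.\<close>
  have expand: "(\<Sum>b\<in>B. \<phi> b $ i * b $ j) = (if i = j then 1 else 0)" for i j
  proof -
    have "(\<Sum>b\<in>B. vec.representation B (axis i 1) b *s b) = axis i 1"
      using B(2,3) finB by (intro vec.sum_representation_eq) auto
    then have "(\<Sum>b\<in>B. vec.representation B (axis i 1) b *s b) $ j = axis i 1 $ j"
      by simp
    then show ?thesis
      by (simp add: \<phi>_def axis_def)
  qed
  have r_dual: "r (\<phi> b) \<bullet> r b' = (if b = b' then 1 else 0)" if "b' \<in> B" for b b'
  proof -
    have "r (\<phi> b) \<bullet> r b' = of_rat (\<Sum>i\<in>UNIV. \<phi> b $ i * b' $ i)"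
      by (simp add: r_def inner_vec_def of_rat_sum of_rat_mult)
    then show ?thesis
      using dual[OF that] by simp
  qed
  have r_expand: "z = (\<Sum>b\<in>B. (r (\<phi> b) \<bullet> z) *\<^sub>R r b)" for z
  proof -
    have "(\<Sum>b\<in>B. (r (\<phi> b) \<bullet> z) *\<^sub>R r b) $ j = z $ j" for j
    proof -
      have "(\<Sum>b\<in>B. (r (\<phi> b) \<bullet> z) *\<^sub>R r b) $ j = (\<Sum>b\<in>B. \<Sum>i\<in>UNIV. z $ i * of_rat (\<phi> b $ i * b $ j))"
        by (simp add: r_def inner_vec_def sum_distrib_left of_rat_mult mult_ac)
      also have "\<dots> = (\<Sum>i\<in>UNIV. z $ i * of_rat (\<Sum>b\<in>B. \<phi> b $ i * b $ j))"
        by (subst sum.swap) (simp add: of_rat_sum sum_distrib_left)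
      also have "\<dots> = (\<Sum>i\<in>UNIV. if i = j then z $ i else 0)"
        unfolding expand by (intro sum.cong) auto
      finally show ?thesis
        by simp
    qed
    then show ?thesis
      by (simp add: vec_eq_iff)
  qed
  have "\<exists>g N. N > 0 \<and> rvec g = real N *\<^sub>R r (\<phi> b)" for b
  proof -
    have "x \<in> \<rat>" for x :: rat
      by (metis Rats_divide Rats_of_int quotient_of_div surj_pair)
    then obtain N where N: "N > 0" "\<And>i. of_nat N * \<phi> b $ i \<in> \<int>"
      using common_denominator[of "\<lambda>i. \<phi> b $ i"] by blast
    have "\<forall>i. \<exists>k. of_nat N * \<phi> b $ i = of_int k"
      using N(2) by (meson Ints_cases)
    then obtain k where k: "\<And>i. of_nat N * \<phi> b $ i = of_int (k i)"
      by metis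
    have "real_of_int (k i) = real N * of_rat (\<phi> b $ i)" for i
    proof -
      have "real_of_int (k i) = of_rat (of_int (k i))"
        by simp
      also have "\<dots> = real N * of_rat (\<phi> b $ i)"
        unfolding k[symmetric] of_rat_mult by simp
      finally show ?thesis .
    qed
    then have "rvec (\<chi> i. k i) = real N *\<^sub>R r (\<phi> b)"
      by (simp add: vec_eq_iff r_def)
    then show ?thesis
      using N(1) by blast
  qed
  then obtain g N where N: "\<And>b. N b > 0" and g: "\<And>b. rvec (g b) = real (N b) *\<^sub>R r (\<phi> b)"
    by metis
  define G where "G = g ` B \<union> (\<lambda>b. - g b) ` (B - q ` W)"
  have G: "(\<forall>h\<in>G. 0 \<le> rvec h \<bullet> z) \<longleftrightarrow> (\<forall>b\<in>B. 0 \<le> r (\<phi> b) \<bullet> z) \<and> (\<forall>b\<in>B - q ` W. r (\<phi> b) \<bullet> z = 0)" for z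
  proof -
    have "0 \<le> rvec (g b) \<bullet> z \<longleftrightarrow> 0 \<le> r (\<phi> b) \<bullet> z" "0 \<le> rvec (- g b) \<bullet> z \<longleftrightarrow> r (\<phi> b) \<bullet> z \<le> 0" for b
      using N[of b] by (simp_all add: g zero_le_mult_iff mult_le_0_iff)
    then have "(\<forall>h\<in>G. 0 \<le> rvec h \<bullet> z) \<longleftrightarrow>
        (\<forall>b\<in>B. 0 \<le> r (\<phi> b) \<bullet> z) \<and> (\<forall>b\<in>B - q ` W. r (\<phi> b) \<bullet> z \<le> 0)"
      by (simp only: G_def ball_Un ball_simps)
    then show ?thesis
      by (auto simp: antisym)
  qed
  show thesis
  proof
    show "finite G"
      using finB by (simp add: G_def)
    fix z
    show "(\<forall>h\<in>G. 0 \<le> rvec h \<bullet> z) \<longleftrightarrow> (\<exists>a. (\<forall>w\<in>W. 0 \<le> a w) \<and> z = (\<Sum>w\<in>W. a w *\<^sub>R rvec w))"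
      unfolding G
    proof (intro iffI conjI ballI)
      assume z: "(\<forall>b\<in>B. 0 \<le> r (\<phi> b) \<bullet> z) \<and> (\<forall>b\<in>B - q ` W. r (\<phi> b) \<bullet> z = 0)"
      have "z = (\<Sum>b\<in>B. (r (\<phi> b) \<bullet> z) *\<^sub>R r b)"
        by (rule r_expand)
      also have "\<dots> = (\<Sum>b\<in>q ` W. (r (\<phi> b) \<bullet> z) *\<^sub>R r b)"
        using z B(1) finB by (intro sum.mono_neutral_right) auto
      also have "\<dots> = (\<Sum>w\<in>W. (r (\<phi> (q w)) \<bullet> z) *\<^sub>R rvec w)"
        by (simp add: sum.reindex[OF inj] rq)
      finally have "z = (\<Sum>w\<in>W. (r (\<phi> (q w)) \<bullet> z) *\<^sub>R rvec w)" .
      moreover have "\<forall>w\<in>W. 0 \<le> r (\<phi> (q w)) \<bullet> z"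
        using z B(1) by blast
      ultimately show "\<exists>a. (\<forall>w\<in>W. 0 \<le> a w) \<and> z = (\<Sum>w\<in>W. a w *\<^sub>R rvec w)"
        by (intro exI[of _ "\<lambda>w. r (\<phi> (q w)) \<bullet> z"]) blast
    next
      assume "\<exists>a. (\<forall>w\<in>W. 0 \<le> a w) \<and> z = (\<Sum>w\<in>W. a w *\<^sub>R rvec w)"
      then obtain a where a: "\<And>w. w \<in> W \<Longrightarrow> 0 \<le> a w" "z = (\<Sum>w\<in>W. a w *\<^sub>R rvec w)"
        by blast
      have z: "r (\<phi> b) \<bullet> z = (\<Sum>w\<in>W. a w * (if b = q w then 1 else 0))" for b
        unfolding a(2) inner_sum_right using B(1)
        by (intro sum.cong refl) (simp add: rq[symmetric] r_dual image_subset_iff)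
      show "0 \<le> r (\<phi> b) \<bullet> z" for b
        unfolding z using a(1) by (intro sum_nonneg) auto
      show "r (\<phi> b) \<bullet> z = 0" if "b \<in> B - q ` W" for b
        unfolding z using that by (intro sum.neutral) auto
    qed
  qed
qed

section \<open>Homogeneous coordinates\<close>

definition lift :: "real ^ 'n \<Rightarrow> real ^ 'n option" where
  "lift x = (\<chi> j. case j of Some i \<Rightarrow> x $ i | None \<Rightarrow> 1)"

text \<open>The point where the ray of \<open>v\<close> meets height 1, provided that the coordinate
  \<open>None\<close> is positive.\<close>

definition proj :: "int ^ 'n option \<Rightarrow> real ^ 'n" where
  "proj v = (\<chi> i. v $ Some i / v $ None)"

lemma lift_nth [simp]: "lift x $ None = 1" "lift x $ Some i = x $ i"
  by (simp_all add: lift_def)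

lemma vec_option_eq_iff: "x = y \<longleftrightarrow> x $ None = y $ None \<and> (\<forall>i. x $ Some i = y $ Some i)"
  unfolding vec_eq_iff by (metis option.exhaust)

lemma lift_eq_iff [simp]: "lift x = lift y \<longleftrightarrow> x = y"
  by (auto simp: vec_option_eq_iff vec_eq_iff[where 'b = 'a])

lemma lift_affine:
  assumes "sum u S = 1"
  shows "lift (\<Sum>x\<in>S. u x *\<^sub>R f x) = (\<Sum>x\<in>S. u x *\<^sub>R lift (f x))"
  using assms by (simp add: vec_option_eq_iff)

lemma lift_scale_sum:
  assumes "t *\<^sub>R lift y = (\<Sum>x\<in>S. u x *\<^sub>R lift (f x))"
  shows "t = sum u S" "t *\<^sub>R y = (\<Sum>x\<in>S. u x *\<^sub>R f x)"
proof -
  show "t = sum u S"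
    using arg_cong[OF assms, of "\<lambda>z. z $ None"] by simp
  have "(t *\<^sub>R y) $ i = (\<Sum>x\<in>S. u x *\<^sub>R f x) $ i" for i
    using arg_cong[OF assms, of "\<lambda>z. z $ Some i"] by simp
  then show "t *\<^sub>R y = (\<Sum>x\<in>S. u x *\<^sub>R f x)"
    by (simp add: vec_eq_iff)
qed

lemma rvec_eq_lift_proj:
  assumes "v $ None \<noteq> 0"
  shows "rvec v = real_of_int (v $ None) *\<^sub>R lift (proj v)"
  using assms by (simp add: vec_option_eq_iff proj_def)

section \<open>Denominators and primitive integral vectors\<close>

lemma den_rational_point:
  assumes "rational_point v"
  shows "den v > 0" "real (den v) * v $ i \<in> \<int>"
proof -
  have "\<exists>d>0. \<forall>i. real d * v $ i \<in> \<int>"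
    using common_denominator[of "\<lambda>i. v $ i"] assms by (simp add: rational_point_def)
  then have "den v > 0 \<and> (\<forall>i. real (den v) * v $ i \<in> \<int>)"
    unfolding den_def by (rule LeastI_ex)
  then show "den v > 0" "real (den v) * v $ i \<in> \<int>"
    by auto
qed

lemma rvec_homogeneous:
  assumes "rational_point v"
  shows "rvec (homogeneous v) = real (den v) *\<^sub>R lift v"
  using den_rational_point(2)[OF assms] by (simp add: vec_option_eq_iff homogeneous_def)

lemma inj_on_homogeneous:
  assumes "\<And>v. v \<in> C \<Longrightarrow> rational_point v"
  shows "inj_on homogeneous C"
proof (rule inj_onI)
  fix v w assume vw: "v \<in> C" "w \<in> C" "homogeneous v = homogeneous w"
  have eq: "real (den v) *\<^sub>R lift v = real (den w) *\<^sub>R lift w"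
    unfolding rvec_homogeneous[OF assms[OF vw(1)], symmetric] rvec_homogeneous[OF assms[OF vw(2)], symmetric]
    by (simp only: vw(3))
  have "den v = den w"
    using arg_cong[OF eq, of "\<lambda>z. z $ None"] by simp
  then show "v = w"
    using eq den_rational_point(1)[OF assms[OF vw(2)]] by simp
qed

text \<open>Members of an integral basis are primitive: the coordinate functional of
  \<open>v\<close> turns the relation into \<open>a = t * pairing \<phi> k\<close>.\<close>

lemma int_basis_primitive:
  assumes B: "int_basis B" "v \<in> B" and k: "a *s v = t *s k"
  shows "t dvd a"
proof -
  obtain \<phi> where \<phi>: "\<And>b'. b' \<in> B \<Longrightarrow> pairing \<phi> b' = (if b' = v then 1 else 0)"
    using int_basis_dual[OF B] by metis
  have scale: "pairing \<phi> (c *s x) = c * pairing \<phi> x" for c x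
    by (simp add: pairing_def sum_distrib_left mult.left_commute)
  have "a = t * pairing \<phi> k"
    using arg_cong[OF k, of "pairing \<phi>"] \<phi>[OF B(2)] by (simp add: scale)
  then show ?thesis
    by simp
qed

text \<open>If \<open>d\<close> clears the denominators of \<open>proj v\<close>, then
  \<open>int d *s v\<close> is \<open>v $ None\<close> times an integral vector, and primitivity of
  \<open>v\<close> gives \<open>v $ None dvd int d\<close>. So the denominator is exactly the last
  coordinate.\<close>

lemma homogeneous_proj:
  assumes B: "int_basis B" "v \<in> B" and pos: "v $ None > 0"
  shows "homogeneous (proj v) = v" and "rational_point (proj v)"
proof -
  have "proj v $ i \<in> \<rat>" for i
    by (simp add: proj_def)
  then show "rational_point (proj v)"
    by (simp add: rational_point_def)
  have "den (proj v) = nat (v $ None)"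
    unfolding den_def
  proof (rule Least_equality)
    show "0 < nat (v $ None) \<and> (\<forall>i. real (nat (v $ None)) * proj v $ i \<in> \<int>)"
      using pos by (simp add: proj_def)
  next
    fix d assume d: "0 < d \<and> (\<forall>i. real d * proj v $ i \<in> \<int>)"
    then have "\<forall>i. \<exists>k. real d * proj v $ i = real_of_int k"
      by (meson Ints_cases)
    then obtain k where k: "\<And>i. real d * proj v $ i = real_of_int (k i)"
      by metis
    have "int d * v $ Some i = v $ None * k i" for i
    proof -
      have "real d * v $ Some i = v $ None * real_of_int (k i)"
        using k[of i] pos by (simp add: proj_def field_simps)
      then have "real_of_int (int d * v $ Some i) = real_of_int (v $ None * k i)"
        by simp
      then show ?thesis
        by (simp only: of_int_eq_iff)
    qed
    then have "int d *s v = (v $ None) *s (\<chi> j. case j of Some i \<Rightarrow> k i | None \<Rightarrow> int d)"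
      by (simp add: vec_option_eq_iff)
    then have "v $ None dvd int d"
      using int_basis_primitive[OF B] by blast
    then show "nat (v $ None) \<le> d"
      using d by (auto dest: zdvd_imp_le)
  qed
  then show "homogeneous (proj v) = v"
    using pos by (simp add: homogeneous_def proj_def vec_option_eq_iff)
qed

text \<open>The cone over \<open>T\<close> is generated by the homogeneous vectors of its vertices.
  They are linearly independent because the vertices are affinely independent, so the half-space
  description of simplicial cones applies. The apex is listed separately because it is no positive
  multiple of a lift.\<close>

lemma rational_simplex_halfspaces:
  fixes T :: "(real ^ 'n) set"
  assumes "rational_simplex T"
  obtains G :: "(int ^ 'n option) set" where "finite G"
    "\<And>z. (\<forall>g\<in>G. 0 \<le> rvec g \<bullet> z) \<longleftrightarrow> z = 0 \<or> (\<exists>t>0. \<exists>x\<in>T. z = t *\<^sub>R lift x)"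
proof -
  obtain C where C: "\<not> affine_dependent C" "T = convex hull C"
    using assms by (auto simp: rational_simplex_def simplex_def)
  then have rat: "rational_point c" if "c \<in> C" for c
    using assms that by (simp add: rational_simplex_def vertices_convex_hull)
  have fin: "finite C"
    using C(1) by (rule aff_independent_finite)
  have inj: "inj_on homogeneous C"
    using rat by (rule inj_on_homogeneous)
  have sum_W: "(\<Sum>w\<in>homogeneous ` C. u w *\<^sub>R rvec w) = (\<Sum>c\<in>C. (u (homogeneous c) * den c) *\<^sub>R lift c)" for u
    by (simp add: sum.reindex[OF inj] rvec_homogeneous rat)
  have ind: "\<forall>w\<in>homogeneous ` C. u w = 0" if "(\<Sum>w\<in>homogeneous ` C. u w *\<^sub>R rvec w) = 0" for u
  proof -
    let ?U = "\<lambda>c. u (homogeneous c) * den c"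
    have "(\<Sum>c\<in>C. ?U c *\<^sub>R lift c) = 0"
      using that by (simp only: sum_W)
    \<comment> \<open>Zero is written as the multiple 0 of a dummy lift: the coordinate
      \<open>None\<close> then says that the coefficients sum to 0, the others that the combination
      of the vertices is 0.\<close>
    then have "0 *\<^sub>R lift 0 = (\<Sum>c\<in>C. ?U c *\<^sub>R lift c)"
      by simp
    then have "sum ?U C = 0" "(\<Sum>c\<in>C. ?U c *\<^sub>R c) = 0"
      using lift_scale_sum[of 0 0 ?U "\<lambda>c. c" C] by simp_all
    then have "\<forall>c\<in>C. ?U c = 0"
      using C(1) affine_dependent_explicit_finite[OF fin] by blast
    then show ?thesis
      using den_rational_point(1) rat by force
  qed
  obtain G :: "(int ^ 'n option) set" where G: "finite G"
    "\<And>z. (\<forall>g\<in>G. 0 \<le> rvec g \<bullet> z) \<longleftrightarrow>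
      (\<exists>a. (\<forall>w\<in>homogeneous ` C. 0 \<le> a w) \<and> z = (\<Sum>w\<in>homogeneous ` C. a w *\<^sub>R rvec w))"
    by (rule finite_cone_halfspaces[OF finite_imageI[OF fin] ind]) (assumption, rule that)
  show thesis
  proof
    show "finite G" by (fact G(1))
    fix z
    show "(\<forall>g\<in>G. 0 \<le> rvec g \<bullet> z) \<longleftrightarrow> z = 0 \<or> (\<exists>t>0. \<exists>x\<in>T. z = t *\<^sub>R lift x)"
      unfolding G(2)
    proof
      assume "\<exists>a. (\<forall>w\<in>homogeneous ` C. 0 \<le> a w) \<and> z = (\<Sum>w\<in>homogeneous ` C. a w *\<^sub>R rvec w)"
      then obtain a where a: "\<And>c. c \<in> C \<Longrightarrow> 0 \<le> a (homogeneous c)"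
        "z = (\<Sum>w\<in>homogeneous ` C. a w *\<^sub>R rvec w)"
        by auto
      define b where "b c = a (homogeneous c) * den c" for c
      have b: "\<And>c. c \<in> C \<Longrightarrow> 0 \<le> b c" "z = (\<Sum>c\<in>C. b c *\<^sub>R lift c)"
        using a by (simp_all add: b_def sum_W)
      show "z = 0 \<or> (\<exists>t>0. \<exists>x\<in>T. z = t *\<^sub>R lift x)"
      proof (cases "sum b C = 0")
        case True
        then have "\<forall>c\<in>C. b c = 0"
          using b(1) fin by (simp add: sum_nonneg_eq_0_iff)
        then show ?thesis
          by (simp add: b(2))
      next
        case False
        let ?t = "sum b C"
        have t: "?t > 0"
          using False b(1) by (simp add: sum_nonneg less_le)
        have one: "(\<Sum>c\<in>C. b c / ?t) = 1"
          using t by (simp add: sum_divide_distrib[symmetric])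
        then have "(\<Sum>c\<in>C. (b c / ?t) *\<^sub>R c) \<in> T"
          using t b(1) unfolding C(2)
          by (intro convex_sum[OF fin convex_convex_hull]) (auto intro: hull_inc)
        moreover have "lift (\<Sum>c\<in>C. (b c / ?t) *\<^sub>R c) = (\<Sum>c\<in>C. (b c / ?t) *\<^sub>R lift c)"
          using one by (rule lift_affine)
        moreover have "z = ?t *\<^sub>R (\<Sum>c\<in>C. (b c / ?t) *\<^sub>R lift c)"
          using t by (simp add: b(2) scaleR_sum_right)
        ultimately show ?thesis
          using t by metis
      qed
    next
      assume "z = 0 \<or> (\<exists>t>0. \<exists>x\<in>T. z = t *\<^sub>R lift x)"
      then have "\<exists>b. (\<forall>c\<in>C. 0 \<le> b c) \<and> z = (\<Sum>c\<in>C. b c *\<^sub>R lift c)"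
      proof
        assume "z = 0"
        then show ?thesis
          by (intro exI[of _ "\<lambda>_. 0"]) simp
      next
        assume "\<exists>t>0. \<exists>x\<in>T. z = t *\<^sub>R lift x"
        then obtain t x where t: "t > 0" "x \<in> T" "z = t *\<^sub>R lift x"
          by blast
        then obtain u where u: "\<And>c. c \<in> C \<Longrightarrow> 0 \<le> u c" "sum u C = 1" "(\<Sum>c\<in>C. u c *\<^sub>R c) = x"
          unfolding C(2) convex_hull_finite[OF fin] by blast
        have "z = (\<Sum>c\<in>C. (t * u c) *\<^sub>R lift c)"
          unfolding t(3) u(3)[symmetric] lift_affine[OF u(2)] by (simp add: scaleR_sum_right)
        then show ?thesis
          using t(1) u(1) by (intro exI[of _ "\<lambda>c. t * u c"]) simp
      qed
      then obtain b where b: "\<And>c. c \<in> C \<Longrightarrow> 0 \<le> b c" "z = (\<Sum>c\<in>C. b c *\<^sub>R lift c)"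
        by blast
      define a where "a w = b (the_inv_into C homogeneous w) / den (the_inv_into C homogeneous w)" for w
      have a: "a (homogeneous c) = b c / den c" if "c \<in> C" for c
        using that by (simp add: a_def the_inv_into_f_f[OF inj])
      have "z = (\<Sum>w\<in>homogeneous ` C. a w *\<^sub>R rvec w)"
        unfolding sum_W b(2) using den_rational_point(1)[OF rat] by (intro sum.cong) (auto simp: a)
      then show "\<exists>a. (\<forall>w\<in>homogeneous ` C. 0 \<le> a w) \<and> z = (\<Sum>w\<in>homogeneous ` C. a w *\<^sub>R rvec w)"
        using b(1) a by (intro exI[of _ a]) auto
    qed
  qed
qed

section \<open>Triangulations from fans\<close>

context
  fixes K :: "(int ^ 'n::finite option) set set" and \<sigma> :: "(int ^ 'n option) set"
  assumes K: "regular_fan K" and \<sigma>: "\<sigma> \<in> K" and pos: "\<And>v. v \<in> \<sigma> \<Longrightarrow> 0 < v $ None"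
begin

lemma combine_independent:
  assumes "(\<Sum>v\<in>\<sigma>. u v *\<^sub>R rvec v) = 0" "w \<in> \<sigma>"
  shows "u w = 0"
proof -
  obtain B where B: "int_basis B" "\<sigma> \<subseteq> B"
    using regular_fanD(5)[OF K \<sigma>] by blast
  obtain \<phi> where \<phi>: "\<And>b'. b' \<in> B \<Longrightarrow> pairing \<phi> b' = (if b' = w then 1 else 0)"
    using int_basis_dual[OF B(1) subsetD[OF B(2) assms(2)]] by metis
  have "0 = rvec \<phi> \<bullet> (\<Sum>v\<in>\<sigma>. u v *\<^sub>R rvec v)"
    by (simp add: assms(1))
  also have "\<dots> = (\<Sum>v\<in>\<sigma>. if v = w then u v else 0)"
    unfolding inner_sum_right using B(2) by (intro sum.cong refl) (auto simp: \<phi> subset_iff)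
  also have "\<dots> = u w"
    using regular_fanD(3)[OF K \<sigma>] assms(2) by simp
  finally show ?thesis
    by simp
qed

lemma rvec_cell: "v \<in> \<sigma> \<Longrightarrow> rvec v = real_of_int (v $ None) *\<^sub>R lift (proj v)"
  using pos[of v] by (intro rvec_eq_lift_proj) simp

lemma inj_on_proj: "inj_on proj \<sigma>"
proof (rule inj_onI, rule ccontr)
  fix v w assume vw: "v \<in> \<sigma>" "w \<in> \<sigma>" "proj v = proj w" "v \<noteq> w"
  \<comment> \<open>Generators over the same point are proportional; exchanging their last
    coordinates gives a linear relation between them.\<close>
  define u where "u x = (if x = v then real_of_int (w $ None) else if x = w then - real_of_int (v $ None) else 0)" for x
  have "(\<Sum>x\<in>\<sigma>. u x *\<^sub>R rvec x) = (\<Sum>x\<in>{v, w}. u x *\<^sub>R rvec x)"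
    using vw regular_fanD(3)[OF K \<sigma>] by (intro sum.mono_neutral_right) (auto simp: u_def)
  also have "\<dots> = 0"
    using vw by (simp add: u_def rvec_cell)
  finally have "u v = 0"
    using combine_independent vw(1) by blast
  then show False
    using pos[OF vw(2)] by (simp add: u_def)
qed

lemma affine_independent_proj: "\<not> affine_dependent (proj ` \<sigma>)"
proof
  have fin: "finite \<sigma>"
    using regular_fanD(3)[OF K \<sigma>] .
  assume "affine_dependent (proj ` \<sigma>)"
  then obtain U where U: "sum U (proj ` \<sigma>) = 0" "\<exists>p\<in>proj ` \<sigma>. U p \<noteq> 0" "(\<Sum>p\<in>proj ` \<sigma>. U p *\<^sub>R p) = 0"
    using affine_dependent_explicit_finite[of "proj ` \<sigma>"] fin by blast
  have U': "(\<Sum>v\<in>\<sigma>. U (proj v)) = 0" "(\<Sum>v\<in>\<sigma>. U (proj v) *\<^sub>R proj v) = 0"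
    using U(1,3) by (simp_all add: sum.reindex[OF inj_on_proj])
  have "(\<Sum>v\<in>\<sigma>. (U (proj v) / v $ None) *\<^sub>R rvec v) = (\<Sum>v\<in>\<sigma>. U (proj v) *\<^sub>R lift (proj v))"
    using pos by (intro sum.cong refl) (force simp: rvec_cell)
  also have "\<dots> = 0"
  proof -
    have "(\<Sum>v\<in>\<sigma>. U (proj v) *\<^sub>R lift (proj v)) $ Some i = (\<Sum>v\<in>\<sigma>. U (proj v) *\<^sub>R proj v) $ i" for i
      by simp
    then show ?thesis
      unfolding vec_option_eq_iff U'(2) by (simp add: U'(1))
  qed
  finally have "U (proj v) / v $ None = 0" if "v \<in> \<sigma>" for v
    using combine_independent[of "\<lambda>v. U (proj v) / v $ None"] that by blast
  then show False
    using U(2) pos by fastforce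
qed

text \<open>Barycentric coordinates at \<open>proj v\<close> are the cone weights multiplied by
  \<open>v $ None\<close>. This carries injectivity of \<open>combine\<close> over to the simplexes
  at height 1.\<close>

lemma mem_cell_iff:
  "x \<in> convex hull (proj ` \<sigma>) \<longleftrightarrow> (\<exists>c\<in>weights K. {v. c v \<noteq> 0} \<subseteq> \<sigma> \<and> combine c = lift x)"
proof
  have fin: "finite \<sigma>"
    using regular_fanD(3)[OF K \<sigma>] .
  {
    assume "x \<in> convex hull (proj ` \<sigma>)"
    then obtain u where u: "\<And>v. v \<in> \<sigma> \<Longrightarrow> 0 \<le> u (proj v)" "sum u (proj ` \<sigma>) = 1"
      "(\<Sum>p\<in>proj ` \<sigma>. u p *\<^sub>R p) = x"
      unfolding convex_hull_finite[OF finite_imageI[OF fin]] by auto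
    then have u': "(\<Sum>v\<in>\<sigma>. u (proj v)) = 1" "(\<Sum>v\<in>\<sigma>. u (proj v) *\<^sub>R proj v) = x"
      by (simp_all add: sum.reindex[OF inj_on_proj])
    define c where "c v = (if v \<in> \<sigma> then u (proj v) / v $ None else 0)" for v
    have supp: "{v. c v \<noteq> 0} \<subseteq> \<sigma>"
      by (auto simp: c_def)
    have "c \<in> weights K"
      using regular_fanD(4)[OF K \<sigma> supp] u(1) pos by (auto simp: weights_def c_def less_imp_le)
    moreover have "combine c = (\<Sum>v\<in>\<sigma>. u (proj v) *\<^sub>R lift (proj v))"
      unfolding combine_eq_sum[OF fin supp] using pos
      by (intro sum.cong refl) (force simp: c_def rvec_cell)
    ultimately show "\<exists>c\<in>weights K. {v. c v \<noteq> 0} \<subseteq> \<sigma> \<and> combine c = lift x"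
      using supp lift_affine[OF u'(1), of proj] u'(2) by auto
  }
  {
    assume "\<exists>c\<in>weights K. {v. c v \<noteq> 0} \<subseteq> \<sigma> \<and> combine c = lift x"
    then obtain c where c: "c \<in> weights K" "{v. c v \<noteq> 0} \<subseteq> \<sigma>" "combine c = lift x"
      by blast
    have "1 *\<^sub>R lift x = (\<Sum>v\<in>\<sigma>. (c v * v $ None) *\<^sub>R lift (proj v))"
      using combine_eq_sum[OF fin c(2)] by (simp add: c(3) rvec_cell)
    then have "(\<Sum>v\<in>\<sigma>. c v * v $ None) = 1" "x = (\<Sum>v\<in>\<sigma>. (c v * v $ None) *\<^sub>R proj v)"
      using lift_scale_sum[of 1 x "\<lambda>v. c v * v $ None" proj \<sigma>] by auto
    moreover have "0 \<le> c v * v $ None" if "v \<in> \<sigma>" for v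
      using weightsD(1)[OF c(1), of v] pos[OF that] by simp
    ultimately show "x \<in> convex hull (proj ` \<sigma>)"
      using convex_sum[OF fin convex_convex_hull, of "\<lambda>v. c v * v $ None" proj "proj ` \<sigma>"]
      by (simp add: hull_inc)
  }
qed

lemma regular_simplex_cell: "regular_simplex (convex hull (proj ` \<sigma>))"
proof -
  let ?S = "convex hull (proj ` \<sigma>)"
  obtain B where B: "int_basis B" "\<sigma> \<subseteq> B"
    using regular_fanD(5)[OF K \<sigma>] by blast
  have vert: "vertices ?S = proj ` \<sigma>"
    using affine_independent_proj by (rule vertices_convex_hull)
  have "\<exists>k. k simplex ?S"
    using affine_independent_proj unfolding simplex_def
    by (intro exI[of _ "int (card (proj ` \<sigma>)) - 1"] exI[of _ "proj ` \<sigma>"]) simp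
  moreover have "rational_point (proj v)" "homogeneous (proj v) = v" if "v \<in> \<sigma>" for v
    using homogeneous_proj[OF B(1) subsetD[OF B(2) that] pos[OF that]] by simp_all
  ultimately show ?thesis
    unfolding regular_simplex_def rational_simplex_def vert using B by (auto simp: image_image)
qed

end

text \<open>A common point has a weight supported on each of the two cones. Both combine to its
  lift, so they agree by injectivity and are supported on the intersection.\<close>

lemma cell_inter:
  assumes K: "regular_fan K" and \<sigma>: "\<sigma> \<in> K" "\<And>v. v \<in> \<sigma> \<Longrightarrow> 0 < v $ None"
    and \<tau>: "\<tau> \<in> K" "\<And>v. v \<in> \<tau> \<Longrightarrow> 0 < v $ None"
  shows "convex hull (proj ` \<sigma>) \<inter> convex hull (proj ` \<tau>) = convex hull (proj ` (\<sigma> \<inter> \<tau>))"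
proof
  show "convex hull (proj ` (\<sigma> \<inter> \<tau>)) \<subseteq> convex hull (proj ` \<sigma>) \<inter> convex hull (proj ` \<tau>)"
    by (intro Int_greatest hull_mono image_mono) auto
  show "convex hull (proj ` \<sigma>) \<inter> convex hull (proj ` \<tau>) \<subseteq> convex hull (proj ` (\<sigma> \<inter> \<tau>))"
  proof
    fix x assume "x \<in> convex hull (proj ` \<sigma>) \<inter> convex hull (proj ` \<tau>)"
    then obtain c d where c: "c \<in> weights K" "{v. c v \<noteq> 0} \<subseteq> \<sigma>" "combine c = lift x"
      and d: "d \<in> weights K" "{v. d v \<noteq> 0} \<subseteq> \<tau>" "combine d = lift x"
      using mem_cell_iff[OF K \<sigma>] mem_cell_iff[OF K \<tau>] by blast
    then have "c = d"
      using inj_onD[OF regular_fanD(6)[OF K]] by metis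
    then have "{v. c v \<noteq> 0} \<subseteq> \<sigma> \<inter> \<tau>"
      using c(2) d(2) by simp
    moreover have "\<sigma> \<inter> \<tau> \<in> K"
      using regular_fanD(4)[OF K \<sigma>(1)] by simp
    ultimately show "x \<in> convex hull (proj ` (\<sigma> \<inter> \<tau>))"
      using mem_cell_iff[OF K, of "\<sigma> \<inter> \<tau>"] \<sigma>(2) c(1,3) by blast
  qed
qed

text \<open>If all pairings are nonpositive, a positive combination can only be nonnegative when
  every summand vanishes.\<close>

lemma non_crossing_sum_nonneg:
  assumes g: "(\<forall>v\<in>\<sigma>. 0 \<le> pairing g v) \<or> (\<forall>v\<in>\<sigma>. pairing g v \<le> 0)"
    and fin: "finite \<sigma>" and c: "\<And>v. v \<in> \<sigma> \<Longrightarrow> 0 < c v"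
    and sum: "0 \<le> rvec g \<bullet> (\<Sum>v\<in>\<sigma>. c v *\<^sub>R rvec v)" and v: "v \<in> \<sigma>"
  shows "0 \<le> pairing g v"
  using g
proof
  assume neg: "\<forall>v\<in>\<sigma>. pairing g v \<le> 0"
  have summand: "0 \<le> - (c v * pairing g v)" if "v \<in> \<sigma>" for v
    using c[OF that] bspec[OF neg that] by (simp add: mult_le_0_iff)
  moreover have "(\<Sum>v\<in>\<sigma>. - (c v * pairing g v)) \<le> 0"
    using sum by (simp add: inner_sum_right sum_negf)
  then have "(\<Sum>v\<in>\<sigma>. - (c v * pairing g v)) = 0"
    using summand by (intro antisym sum_nonneg)
  ultimately have "- (c v * pairing g v) = 0"
    using sum_nonneg_eq_0_iff[OF fin, of "\<lambda>v. - (c v * pairing g v)"] v by blast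
  then show ?thesis
    using c[OF v] by simp
qed (use v in blast)

text \<open>Each \<open>g\<close> in \<open>G\<close> is nonnegative at \<open>lift x\<close> and
  does not cross the carrier of \<open>x\<close>, hence is nonnegative at all its generators. These
  therefore lie in the cone over \<open>S\<close>.\<close>

lemma carrier_in_simplex:
  assumes K: "regular_fan K" and c: "c \<in> weights K" "combine c = lift x"
    and S: "convex S" "x \<in> S"
    and G: "\<And>z. (\<forall>g\<in>G. 0 \<le> rvec g \<bullet> z) \<longleftrightarrow> z = 0 \<or> (\<exists>t>0. \<exists>x\<in>S. z = t *\<^sub>R lift x)"
    and non_crossing: "\<And>g. g \<in> G \<Longrightarrow> non_crossing g K"
  shows "(\<forall>v. c v \<noteq> 0 \<longrightarrow> 0 < v $ None) \<and> convex hull (proj ` {v. c v \<noteq> 0}) \<subseteq> S"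
proof -
  let ?\<sigma> = "{v. c v \<noteq> 0}"
  have \<sigma>: "?\<sigma> \<in> K"
    using weightsD(2)[OF c(1)] .
  have v: "0 < v $ None \<and> proj v \<in> S" if "v \<in> ?\<sigma>" for v
  proof -
    have "lift x = 1 *\<^sub>R lift x"
      by simp
    then have "\<forall>g\<in>G. 0 \<le> rvec g \<bullet> lift x"
      unfolding G using S(2) zero_less_one by blast
    then have "0 \<le> rvec g \<bullet> (\<Sum>v\<in>?\<sigma>. c v *\<^sub>R rvec v)" if "g \<in> G" for g
      using that c(2) by (simp add: combine_def)
    moreover have "0 < c v" if "v \<in> ?\<sigma>" for v
      using that weightsD(1)[OF c(1), of v] by simp
    ultimately have "0 \<le> pairing g v" if "g \<in> G" for g
      using non_crossing_sum_nonneg[OF bspec[OF non_crossing[OF that, unfolded non_crossing_def] \<sigma>]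
        regular_fanD(3)[OF K \<sigma>], of c v] \<open>v \<in> ?\<sigma>\<close> that by blast
    then have "\<forall>g\<in>G. 0 \<le> rvec g \<bullet> rvec v"
      by simp
    then have "rvec v = 0 \<or> (\<exists>t>0. \<exists>y\<in>S. rvec v = t *\<^sub>R lift y)"
      unfolding G .
    \<comment> \<open>The apex satisfies all inequalities too, but it is not a member of an integral
      basis.\<close>
    moreover have "rvec v \<noteq> 0"
    proof
      assume "rvec v = 0"
      then have v0: "v = 0"
        using rvec_eq_iff[of v 0] by simp
      obtain B where B: "int_basis B" "?\<sigma> \<subseteq> B"
        using regular_fanD(5)[OF K \<sigma>] by blast
      then have "v \<in> B"
        using that by blast
      then obtain \<phi> where "pairing \<phi> v = 1"
        using int_basis_dual[OF B(1)] by metis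
      then show False
        by (simp add: v0 pairing_def)
    qed
    ultimately obtain t y where ty: "t > 0" "y \<in> S" "rvec v = t *\<^sub>R lift y"
      by blast
    have None: "real_of_int (v $ None) = t"
      using arg_cong[OF ty(3), of "\<lambda>z. z $ None"] by simp
    have "proj v $ i = y $ i" for i
      using arg_cong[OF ty(3), of "\<lambda>z. z $ Some i"] ty(1) by (simp add: proj_def None)
    then have "proj v = y"
      by (simp add: vec_eq_iff)
    then show ?thesis
      using None ty by simp
  qed
  then have "convex hull (proj ` ?\<sigma>) \<subseteq> S"
    using S(1) by (intro hull_minimal) blast+
  then show ?thesis
    using v by blast
qed

text \<open>Resolving the functionals of all simplexes of \<open>\<F>\<close> at once puts the
  carrier of every point of \<open>P\<close> inside a simplex containing that point. The slices
  contained in \<open>P\<close> thus cover it, and they meet in common faces by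
  \<open>cell_inter\<close>.\<close>

theorem regular_triangulation_exists:
  fixes P :: "(real ^ 'n) set"
  assumes "rational_polyhedron P"
  obtains \<T> where "rational_triangulation_of \<T> P" "\<forall>S\<in>\<T>. regular_simplex S"
proof -
  obtain \<F> where \<F>: "finite \<F>" "\<And>S. S \<in> \<F> \<Longrightarrow> rational_simplex S" "P = \<Union>\<F>"
    using assms by (auto simp: rational_polyhedron_def)
  have "\<exists>G :: (int ^ 'n option) set. finite G \<and>
      (\<forall>z. (\<forall>g\<in>G. 0 \<le> rvec g \<bullet> z) \<longleftrightarrow> z = 0 \<or> (\<exists>t>0. \<exists>x\<in>S. z = t *\<^sub>R lift x))" if "S \<in> \<F>" for S
    by (rule rational_simplex_halfspaces[OF \<F>(2)[OF that]]) blast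
  then obtain G :: "(real ^ 'n) set \<Rightarrow> (int ^ 'n option) set" where G: "\<And>S. S \<in> \<F> \<Longrightarrow> finite (G S)"
    "\<And>S z. S \<in> \<F> \<Longrightarrow> (\<forall>g\<in>G S. 0 \<le> rvec g \<bullet> z) \<longleftrightarrow> z = 0 \<or> (\<exists>t>0. \<exists>x\<in>S. z = t *\<^sub>R lift x)"
    by metis
  obtain K where "refines K orthant_fan" and non_crossing: "\<And>g. g \<in> \<Union>(G ` \<F>) \<Longrightarrow> non_crossing g K"
    using refinement_non_crossing_finite[OF _ regular_fan_orthant, of "\<Union>(G ` \<F>)"] \<F>(1) G(1) by auto
  then have K: "regular_fan K" and surj: "combine ` weights K = UNIV"
    by (simp_all add: refines_def combine_orthant_surj)
  \<comment> \<open>Positive height of all generators makes the slice a simplex. The empty cone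
    belongs to the cells and supplies the empty face that the complex has to contain.\<close>
  define cells where "cells = {\<sigma> \<in> K. (\<forall>v\<in>\<sigma>. 0 < v $ None) \<and> convex hull (proj ` \<sigma>) \<subseteq> P}"
  define \<T> where "\<T> = (\<lambda>\<sigma>. convex hull (proj ` \<sigma>)) ` cells"
  have cellsD: "\<sigma> \<in> K" "v \<in> \<sigma> \<Longrightarrow> 0 < v $ None" "convex hull (proj ` \<sigma>) \<subseteq> P" if "\<sigma> \<in> cells" for \<sigma> v
    using that by (auto simp: cells_def)
  have affine_independent_cell: "\<not> affine_dependent (proj ` \<sigma>)" if "\<sigma> \<in> cells" for \<sigma>
    using cellsD[OF that] by (intro affine_independent_proj[OF K])
  have faces: "T \<in> \<T>" if T: "T face_of convex hull (proj ` \<sigma>)" and \<sigma>: "\<sigma> \<in> cells" for T \<sigma>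
  proof -
    have "\<exists>C. C \<subseteq> proj ` \<sigma> \<and> T = convex hull C"
      using T face_of_convex_hull_affine_independent[OF affine_independent_cell[OF \<sigma>]] by blast
    then obtain \<tau> where \<tau>: "\<tau> \<subseteq> \<sigma>" "T = convex hull (proj ` \<tau>)"
      by (auto simp: subset_image_iff)
    moreover have "T \<subseteq> P"
      using face_of_imp_subset[OF T] cellsD(3)[OF \<sigma>] by blast
    ultimately have "\<tau> \<in> cells"
      using cellsD(2)[OF \<sigma>] regular_fanD(4)[OF K cellsD(1)[OF \<sigma>] \<tau>(1)] by (auto simp: cells_def)
    then show ?thesis
      by (simp add: \<T>_def \<tau>(2))
  qed
  have inter: "convex hull (proj ` \<sigma>) \<inter> convex hull (proj ` \<tau>) face_of convex hull (proj ` \<sigma>)"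
    if \<sigma>: "\<sigma> \<in> cells" and \<tau>: "\<tau> \<in> cells" for \<sigma> \<tau>
  proof -
    have "convex hull (proj ` \<sigma>) \<inter> convex hull (proj ` \<tau>) = convex hull (proj ` (\<sigma> \<inter> \<tau>))"
      using cellsD[OF \<sigma>] cellsD[OF \<tau>] by (intro cell_inter[OF K])
    moreover have "proj ` (\<sigma> \<inter> \<tau>) \<subseteq> proj ` \<sigma>"
      by blast
    ultimately show ?thesis
      unfolding face_of_convex_hull_affine_independent[OF affine_independent_cell[OF \<sigma>]] by (intro exI conjI)
  qed
  have regular: "regular_simplex S" if "S \<in> \<T>" for S
    using that regular_simplex_cell[OF K] cellsD by (auto simp: \<T>_def)
  have "P \<subseteq> \<Union>\<T>"
  proof
    fix x assume "x \<in> P"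
    then obtain S where S: "S \<in> \<F>" "x \<in> S"
      using \<F>(3) by blast
    obtain c where c: "c \<in> weights K" "combine c = lift x"
      using surj by (metis UNIV_I imageE)
    let ?\<sigma> = "{v. c v \<noteq> 0}"
    have "convex S"
      using \<F>(2)[OF S(1)] by (auto simp: rational_simplex_def simplex_def)
    then have \<sigma>: "\<forall>v. c v \<noteq> 0 \<longrightarrow> 0 < v $ None" "convex hull (proj ` ?\<sigma>) \<subseteq> S"
      using carrier_in_simplex[OF K c _ S(2) G(2)[OF S(1)] non_crossing] S(1) by auto
    then have "?\<sigma> \<in> cells"
      using weightsD(2)[OF c(1)] S(1) \<F>(3) by (auto simp: cells_def)
    moreover have "x \<in> convex hull (proj ` ?\<sigma>)"
      using c \<sigma>(1) weightsD(2)[OF c(1)] by (subst mem_cell_iff[OF K]) (auto intro!: bexI[of _ c])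
    ultimately show "x \<in> \<Union>\<T>"
      unfolding \<T>_def by blast
  qed
  moreover have "\<Union>\<T> \<subseteq> P"
    using cellsD(3) unfolding \<T>_def by blast
  moreover have "finite \<T>"
    using regular_fanD(1)[OF K] by (simp add: \<T>_def cells_def)
  moreover have "simplicial_complex \<T>"
    unfolding simplicial_complex_def
  proof (intro conjI ballI allI impI)
    show "finite \<T>" by fact
    show "\<exists>n. n simplex S" if "S \<in> \<T>" for S
      using regular[OF that] by (simp add: regular_simplex_def rational_simplex_def)
    show "F \<in> \<T>" if "S \<in> \<T> \<and> F face_of S" for F S
      using that faces by (auto simp: \<T>_def)
    show "S \<inter> S' face_of S" if "S \<in> \<T> \<and> S' \<in> \<T>" for S S'
      using that inter by (auto simp: \<T>_def)
  qed
  ultimately have "rational_triangulation_of \<T> P"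
    using regular by (auto simp: rational_triangulation_of_def regular_simplex_def)
  then show thesis
    using regular that by blast
qed

section \<open>Strongly regular simplexes\<close>

lemma Gcd_bezout_nat:
  assumes "finite A"
  shows "\<exists>a :: 'b \<Rightarrow> int. (\<Sum>x\<in>A. a x * int (f x)) = int (Gcd (f ` A))"
  using assms
proof (induction A)
  case empty
  then show ?case
    by simp
next
  case (insert y A)
  then obtain a :: "'b \<Rightarrow> int" where a: "(\<Sum>x\<in>A. a x * int (f x)) = int (Gcd (f ` A))"
    by blast
  obtain p q where pq: "p * int (f y) + q * int (Gcd (f ` A)) = gcd (int (f y)) (int (Gcd (f ` A)))"
    using bezout_int by blast
  let ?a = "\<lambda>x. if x = y then p else q * a x"
  have "(\<Sum>x\<in>A. ?a x * int (f x)) = (\<Sum>x\<in>A. q * (a x * int (f x)))"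
    using insert.hyps by (intro sum.cong) auto
  also have "\<dots> = q * int (Gcd (f ` A))"
    by (simp add: sum_distrib_left[symmetric] a)
  finally have "(\<Sum>x\<in>insert y A. ?a x * int (f x)) = int (Gcd (f ` insert y A))"
    using insert.hyps pq by simp
  then show ?case
    by (intro exI[of _ ?a])
qed

lemma rational_simplexE:
  assumes "rational_simplex S"
  obtains C where "\<not> affine_dependent C" "finite C" "S = convex hull C" "vertices S = C"
    "\<forall>c\<in>C. rational_point c"
proof -
  obtain C where C: "\<not> affine_dependent C" "S = convex hull C"
    using assms by (auto simp: rational_simplex_def simplex_def)
  have vert: "vertices S = C"
    using C by (simp add: vertices_convex_hull)
  show thesis
  proof (rule that)
    show "finite C"
      using C(1) by (rule aff_independent_finite)
    show "\<forall>c\<in>C. rational_point c"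
      using assms by (simp add: rational_simplex_def vert)
  qed (fact C vert)+
qed

text \<open>A Bezout relation gives an affine combination of the vertices whose coefficients are
  multiples of their denominators, that is, an integer point. If only one of its coefficients may be
  negative, and \<open>v\<close> has a positive barycentric coordinate there, a short step from
  \<open>v\<close> towards that point stays in \<open>S\<close>.\<close>

lemma strongly_regular_simplex_direction:
  fixes S :: "(real ^ 'n) set"
  assumes S: "strongly_regular_simplex S" and v: "v \<in> S"
  shows "\<exists>w \<epsilon>. integer_point w \<and> \<epsilon> > 0 \<and> convex hull {v, v + \<epsilon> *\<^sub>R (w - v)} \<subseteq> S"
proof -
  have "rational_simplex S"
    using S by (simp add: strongly_regular_simplex_def regular_simplex_def)
  then obtain C where "\<not> affine_dependent C"
    and C: "finite C" "S = convex hull C" "vertices S = C" "\<forall>c\<in>C. rational_point c"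
    by (rule rational_simplexE)
  have gcd: "Gcd (den ` C) = 1"
    using S C(3) by (simp add: strongly_regular_simplex_def)
  then obtain a :: "real ^ 'n \<Rightarrow> int" where a: "(\<Sum>c\<in>C. a c * int (den c)) = 1"
    using Gcd_bezout_nat[OF C(1), of den] by auto
  obtain u where u: "\<And>c. c \<in> C \<Longrightarrow> 0 \<le> u c" "sum u C = 1" "(\<Sum>c\<in>C. u c *\<^sub>R c) = v"
    using v unfolding C(2) convex_hull_finite[OF C(1)] by blast
  obtain j where j: "j \<in> C" "u j > 0"
    using u(1,2) by (metis less_le sum.neutral zero_neq_one)
  \<comment> \<open>Shifting by multiples of the syzygies \<open>den j \<cdot> den c - den c \<cdot> den j = 0\<close> makes every
    coefficient except that of \<open>j\<close> nonnegative.\<close>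
  define m where "m = (\<Sum>c\<in>C. \<bar>a c\<bar>)"
  define a' where "a' c = (if c = j then a j - m * (\<Sum>c\<in>C - {j}. int (den c)) else a c + m * int (den j))" for c
  define b where "b c = real_of_int (a' c * int (den c))" for c
  have sum_a': "(\<Sum>c\<in>C. a' c * int (den c)) = 1"
  proof -
    have "(\<Sum>c\<in>C. a' c * int (den c)) =
        (a j - m * (\<Sum>c\<in>C - {j}. int (den c))) * int (den j) + (\<Sum>c\<in>C - {j}. (a c + m * int (den j)) * int (den c))"
      using C(1) j(1) by (simp add: sum.remove[of C j] a'_def)
    also have "\<dots> = a j * int (den j) + (\<Sum>c\<in>C - {j}. a c * int (den c))"
      by (simp add: algebra_simps sum.distrib sum_distrib_left)
    also have "\<dots> = 1"
      using a C(1) j(1) by (simp add: sum.remove[of C j])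
    finally show ?thesis .
  qed
  have sum_b: "sum b C = 1"
  proof -
    have "sum b C = real_of_int (\<Sum>c\<in>C. a' c * int (den c))"
      by (simp add: b_def)
    then show ?thesis
      by (simp only: sum_a' of_int_1)
  qed
  have b_nonneg: "0 \<le> b c" if "c \<in> C" "c \<noteq> j" for c
  proof -
    have "\<bar>a c\<bar> \<le> m"
      unfolding m_def using C(1) that(1) by (intro member_le_sum) auto
    moreover have "0 \<le> m"
      by (simp add: m_def sum_nonneg)
    then have "m \<le> m * int (den j)"
      using den_rational_point(1)[OF bspec[OF C(4) j(1)]] \<open>0 \<le> m\<close> by (simp add: mult_le_cancel_left1)
    ultimately have "0 \<le> a' c"
      using that(2) by (simp add: a'_def)
    then show ?thesis
      by (simp add: b_def)
  qed
  define w where "w = (\<Sum>c\<in>C. b c *\<^sub>R c)"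
  have "integer_point w"
    unfolding integer_point_def
  proof
    fix i
    have "w $ i = (\<Sum>c\<in>C. real_of_int (a' c) * (real (den c) * c $ i))"
      by (simp add: w_def b_def mult.assoc)
    also have "\<dots> \<in> \<int>"
      using den_rational_point(2)[OF bspec[OF C(4)]] by (intro Ints_sum Ints_mult[OF Ints_of_int])
    finally show "w $ i \<in> \<int>" .
  qed
  \<comment> \<open>Chosen such that the coefficient at \<open>j\<close> after the step is
    \<open>\<epsilon> * (\<bar>b j\<bar> + b j)\<close>, which is nonnegative. The other
    coefficients only require \<open>\<epsilon>\<close> to lie between 0 and 1.\<close>
  define \<epsilon> where "\<epsilon> = u j / (u j + \<bar>b j\<bar>)"
  have \<epsilon>: "0 < \<epsilon>" "\<epsilon> \<le> 1" "\<epsilon> * (u j + \<bar>b j\<bar>) = u j"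
    using j(2) by (simp_all add: \<epsilon>_def)
  have "0 \<le> (1 - \<epsilon>) * u c + \<epsilon> * b c" if "c \<in> C" for c
  proof (cases "c = j")
    case True
    have "(1 - \<epsilon>) * u j + \<epsilon> * b j = \<epsilon> * (\<bar>b j\<bar> + b j)"
      using \<epsilon>(3) by (simp add: algebra_simps)
    then show ?thesis
      using True \<epsilon>(1) by simp
  next
    case False
    then show ?thesis
      using \<epsilon> u(1)[OF that] b_nonneg[OF that] by simp
  qed
  moreover have "(\<Sum>c\<in>C. (1 - \<epsilon>) * u c + \<epsilon> * b c) = 1"
    by (simp add: sum.distrib sum_distrib_left[symmetric] u(2) sum_b)
  ultimately have "(\<Sum>c\<in>C. ((1 - \<epsilon>) * u c + \<epsilon> * b c) *\<^sub>R c) \<in> S"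
    unfolding C(2) using C(1) by (intro convex_sum) (auto intro: hull_inc)
  moreover have "(\<Sum>c\<in>C. ((1 - \<epsilon>) * u c + \<epsilon> * b c) *\<^sub>R c) = (1 - \<epsilon>) *\<^sub>R v + \<epsilon> *\<^sub>R w"
    by (simp add: scaleR_left_distrib sum.distrib scaleR_sum_right u(3)[symmetric] w_def)
  moreover have "(1 - \<epsilon>) *\<^sub>R v + \<epsilon> *\<^sub>R w = v + \<epsilon> *\<^sub>R (w - v)"
    by (simp add: algebra_simps)
  ultimately have "v + \<epsilon> *\<^sub>R (w - v) \<in> S"
    by simp
  then have "convex hull {v, v + \<epsilon> *\<^sub>R (w - v)} \<subseteq> S"
    using v by (intro hull_minimal) (auto simp: C(2))
  then show ?thesis
    using \<open>integer_point w\<close> \<epsilon>(1) by blast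
qed

lemma strongly_regular_simplexI:
  fixes S :: "(real ^ 'n) set"
  assumes S: "regular_simplex S" and w: "integer_point w" "w \<in> affine hull S"
  shows "strongly_regular_simplex S"
proof -
  have "rational_simplex S"
    using S by (simp add: regular_simplex_def)
  then obtain C where "\<not> affine_dependent C"
    and C: "finite C" "S = convex hull C" "vertices S = C" "\<forall>c\<in>C. rational_point c"
    by (rule rational_simplexE)
  obtain B where B: "int_basis B" "homogeneous ` C \<subseteq> B"
    using S C(3) by (auto simp: regular_simplex_def)
  have "w \<in> affine hull C"
    using w(2) by (simp add: C(2))
  then obtain u where u: "sum u C = 1" "(\<Sum>c\<in>C. u c *\<^sub>R c) = w"
    using affine_hull_finite[OF C(1)] by auto
  have "\<forall>i. \<exists>k. w $ i = real_of_int k"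
    using w(1) by (meson Ints_cases integer_point_def)
  then obtain k where k: "\<And>i. w $ i = real_of_int (k i)"
    by metis
  define W :: "int ^ 'n option" where "W = (\<chi> j. case j of Some i \<Rightarrow> k i | None \<Rightarrow> 1)"
  have W: "rvec W = (\<Sum>c\<in>C. u c *\<^sub>R lift c)"
    using lift_affine[OF u(1), of "\<lambda>c. c"] by (simp add: u(2) vec_option_eq_iff W_def k)
  \<comment> \<open>The coordinate functional of \<open>homogeneous c\<close> takes the value
    \<open>u c / den c\<close> at \<open>W\<close>. This is an integer because \<open>W\<close> is
    integral.\<close>
  have "\<exists>n. u c = real_of_int n * den c" if c: "c \<in> C" for c
  proof -
    have "homogeneous c \<in> B"
      using B(2) c by blast
    then obtain \<phi> where \<phi>: "\<And>b. b \<in> B \<Longrightarrow> pairing \<phi> b = (if b = homogeneous c then 1 else 0)"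
      using int_basis_dual[OF B(1)] by metis
    have "u x * (rvec \<phi> \<bullet> lift x) = (if x = c then u c / den c else 0)" if x: "x \<in> C" for x
    proof -
      have "den x * (rvec \<phi> \<bullet> lift x) = pairing \<phi> (homogeneous x)"
        using rvec_homogeneous[OF bspec[OF C(4) x]] by (metis inner_rvec inner_scaleR_right)
      also have "\<dots> = (if x = c then 1 else 0)"
      proof -
        have "inj_on homogeneous C"
          using C(4) by (intro inj_on_homogeneous) simp
        then have "homogeneous x = homogeneous c \<longleftrightarrow> x = c"
          using x c by (rule inj_on_eq_iff)
        moreover have "homogeneous x \<in> B"
          using B(2) x by blast
        ultimately show ?thesis
          by (simp add: \<phi>)
      qed
      finally show ?thesis
        using den_rational_point(1)[OF bspec[OF C(4) x]] by (auto simp: field_simps split: if_splits)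
    qed
    then have "rvec \<phi> \<bullet> rvec W = (\<Sum>x\<in>C. if x = c then u c / den c else 0)"
      unfolding W inner_sum_right inner_scaleR_right by (intro sum.cong) auto
    then have "real_of_int (pairing \<phi> W) = u c / den c"
      using C(1) c by simp
    then show ?thesis
      using den_rational_point(1)[OF bspec[OF C(4) c]] by (intro exI[of _ "pairing \<phi> W"]) simp
  qed
  then obtain n where n: "\<And>c. c \<in> C \<Longrightarrow> u c = real_of_int (n c) * den c"
    by metis
  have "real_of_int (\<Sum>c\<in>C. n c * int (den c)) = 1"
    using u(1) by (simp add: n)
  then have "(\<Sum>c\<in>C. n c * int (den c)) = 1"
    by linarith
  \<comment> \<open>A common divisor of all denominators divides their integral combination
    1.\<close>
  moreover have "int (Gcd (den ` C)) dvd (\<Sum>c\<in>C. n c * int (den c))"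
    by (intro dvd_sum dvd_mult) (simp add: Gcd_dvd)
  ultimately have "Gcd (den ` C) = 1"
    by simp
  then show ?thesis
    using S C(3) by (simp add: strongly_regular_simplex_def)
qed

section \<open>Integer points in affine hulls of maximal simplexes\<close>

lemma barycenter_rational:
  assumes "\<forall>c\<in>C. rational_point c"
  shows "rational_point (\<Sum>c\<in>C. (1 / real (card C)) *\<^sub>R c)"
  unfolding rational_point_def
proof
  fix i
  have "(\<Sum>c\<in>C. (1 / real (card C)) *\<^sub>R c) $ i = (\<Sum>c\<in>C. (1 / real (card C)) * c $ i)"
    by simp
  also have "\<dots> \<in> \<rat>"
    using assms by (intro Rats_sum Rats_mult Rats_divide) (auto simp: rational_point_def)
  finally show "(\<Sum>c\<in>C. (1 / real (card C)) *\<^sub>R c) $ i \<in> \<rat>" .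
qed

lemma closed_simplex: "k simplex S \<Longrightarrow> closed S"
  by (auto simp: simplex intro!: compact_imp_closed finite_imp_compact_convex_hull)

text \<open>
  Near the barycenter of a maximal simplex, the polyhedron coincides with that simplex.
\<close>

lemma maximal_simplex_affine_hull:
  fixes P :: "(real ^ 'n) set"
  assumes \<T>: "rational_triangulation_of \<T> P" and S: "S \<in> \<T>" "S \<noteq> {}"
    and max: "\<And>S'. S' \<in> \<T> \<Longrightarrow> S \<subseteq> S' \<Longrightarrow> S' = S"
    and dir: "\<And>v. v \<in> P \<Longrightarrow> rational_point v \<Longrightarrow>
      \<exists>w \<epsilon>. integer_point w \<and> \<epsilon> > 0 \<and> convex hull {v, v + \<epsilon> *\<^sub>R (w - v)} \<subseteq> P"
  shows "\<exists>w. integer_point w \<and> w \<in> affine hull S"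
proof -
  have complex: "simplicial_complex \<T>" and P: "\<Union>\<T> = P" and rat: "rational_simplex S"
    using \<T> S(1) by (auto simp: rational_triangulation_of_def)
  obtain C where C: "\<not> affine_dependent C" "finite C" "S = convex hull C"
    and "vertices S = C" and C_rat: "\<forall>c\<in>C. rational_point c"
    using rat by (rule rational_simplexE)
  have card: "real (card C) > 0"
    using S(2) C(2,3) by (auto simp: card_gt_0_iff)
  \<comment> \<open>The barycenter is a rational point in the relative interior, so the hypothesis
    on directions applies and no proper face of \<open>S\<close> contains it.\<close>
  define v where "v = (\<Sum>c\<in>C. (1 / real (card C)) *\<^sub>R c)"
  have v: "v \<in> rel_interior S"
    unfolding C(3) rel_interior_convex_hull_explicit[OF C(1)] v_def
    using card by (intro CollectI exI[of _ "\<lambda>_. 1 / real (card C)"]) simp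
  then have "v \<in> S"
    using rel_interior_subset by blast
  then have "v \<in> P" "rational_point v"
    using P S(1) barycenter_rational C_rat by (auto simp: v_def)
  then obtain w \<epsilon> where w: "integer_point w" "\<epsilon> > 0" "convex hull {v, v + \<epsilon> *\<^sub>R (w - v)} \<subseteq> P"
    using dir by blast
  \<comment> \<open>The simplexes missing \<open>v\<close> form a closed set, so a point close
    enough to \<open>v\<close> can only lie in simplexes that contain \<open>v\<close>.\<close>
  define Z where "Z = \<Union>{S' \<in> \<T>. v \<notin> S'}"
  have "finite \<T>" and "\<forall>S'\<in>\<T>. closed S'"
    using complex closed_simplex unfolding simplicial_complex_def by blast+
  then have "closed Z"
    unfolding Z_def by (intro closed_Union) auto
  moreover have "v \<in> - Z"
    by (simp add: Z_def)
  ultimately obtain \<delta> where \<delta>: "\<delta> > 0" "ball v \<delta> \<subseteq> - Z"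
    using open_contains_ball by (metis open_Compl)
  \<comment> \<open>The summand 1 keeps the divisor positive and makes the distance from
    \<open>v\<close> to \<open>y\<close> strictly smaller than \<open>\<delta>\<close>.\<close>
  define t where "t = min \<epsilon> (\<delta> / (1 + norm (w - v)))"
  have norm: "1 + norm (w - v) > 0"
    by (simp add: add_pos_nonneg)
  have t: "t > 0" "t \<le> \<epsilon>" "t * (1 + norm (w - v)) \<le> \<delta>"
    using w(2) \<delta>(1) norm unfolding pos_le_divide_eq[OF norm, symmetric] by (simp_all add: t_def)
  define y where "y = v + t *\<^sub>R (w - v)"
  have "dist v y = t * norm (w - v)"
    using t(1) by (simp add: y_def dist_norm)
  also have "\<dots> < \<delta>"
    using t by (simp add: distrib_left)
  finally have "dist v y < \<delta>" .
  then have "y \<notin> Z"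
    using \<delta>(2) by auto
  have "y = (1 - t / \<epsilon>) *\<^sub>R v + (t / \<epsilon>) *\<^sub>R (v + \<epsilon> *\<^sub>R (w - v))"
    using w(2) by (simp add: y_def algebra_simps)
  also have "\<dots> \<in> convex hull {v, v + \<epsilon> *\<^sub>R (w - v)}"
    using t w(2) by (intro convexD[OF convex_convex_hull]) (auto intro: hull_inc)
  finally have "y \<in> \<Union>\<T>"
    using w(3) P by blast
  then obtain S' where S': "S' \<in> \<T>" "y \<in> S'" "v \<in> S'"
    using \<open>y \<notin> Z\<close> by (auto simp: Z_def)
  \<comment> \<open>A face that meets the relative interior of \<open>S\<close> is all of
    \<open>S\<close>; maximality then identifies \<open>S'\<close> with \<open>S\<close>.\<close>
  have "S \<inter> S' face_of S"
    using complex S(1) S'(1) by (simp add: simplicial_complex_def)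
  moreover have "S \<inter> S' \<inter> rel_interior S \<noteq> {}"
    using v \<open>v \<in> S\<close> S'(3) by blast
  ultimately have "S \<subseteq> S \<inter> S'"
    by (rule subset_of_face_of[OF _ order_refl])
  then have "S' = S"
    using max S'(1) by blast
  then have "y \<in> affine hull S" "v \<in> affine hull S"
    using S'(2) \<open>v \<in> S\<close> by (auto intro: hull_inc)
  \<comment> \<open>\<open>w\<close> lies on the line through the distinct parameters 0 and
    \<open>t\<close>, whose points \<open>v\<close> and \<open>y\<close> are in the affine
    hull.\<close>
  moreover have "w = (1 - 1 / t) *\<^sub>R v + (1 / t) *\<^sub>R y"
    using t(1) by (simp add: y_def algebra_simps)
  ultimately have "w \<in> affine hull S"
    using mem_affine[OF affine_affine_hull, of v S y "1 - 1 / t" "1 / t"] by simp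
  then show ?thesis
    using w(1) by blast
qed

section \<open>Equivalence of the two conditions\<close>

theorem lemma3p6:
  fixes P :: "(real ^ 'n) set"
  assumes "rational_polyhedron P"
  shows "(\<exists>\<T>. strongly_regular_triangulation_of \<T> P) \<longleftrightarrow>
    (\<forall>v \<in> P. rational_point v \<longrightarrow>
      (\<exists>w \<epsilon>. integer_point w \<and> \<epsilon> > 0 \<and> convex hull {v, v + \<epsilon> *\<^sub>R (w - v)} \<subseteq> P))"
proof
  assume "\<exists>\<T>. strongly_regular_triangulation_of \<T> P"
  then obtain \<T> where complex: "simplicial_complex \<T>" and P: "\<Union>\<T> = P"
    and strong: "\<And>S. \<lbrakk>S \<in> \<T>; \<forall>S'\<in>\<T>. S \<subseteq> S' \<longrightarrow> S' = S\<rbrakk> \<Longrightarrow> strongly_regular_simplex S"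
    by (auto simp: strongly_regular_triangulation_of_def rational_triangulation_of_def)
  show "\<forall>v \<in> P. rational_point v \<longrightarrow>
      (\<exists>w \<epsilon>. integer_point w \<and> \<epsilon> > 0 \<and> convex hull {v, v + \<epsilon> *\<^sub>R (w - v)} \<subseteq> P)"
  proof (intro ballI impI)
    fix v assume "v \<in> P"
    then obtain S0 where S0: "S0 \<in> \<T>" "v \<in> S0"
      using P by blast
    have "finite \<T>"
      using complex by (simp add: simplicial_complex_def)
    \<comment> \<open>Strong regularity is known for maximal simplexes only; by finiteness one of
      them contains \<open>S0\<close>.\<close>
    then obtain S where S: "S \<in> \<T>" "S0 \<subseteq> S" "\<forall>S'\<in>\<T>. S \<subseteq> S' \<longrightarrow> S = S'"
      using finite_has_maximal2[of \<T> S0] S0(1) by blast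
    then have "strongly_regular_simplex S"
      using strong by blast
    then obtain w \<epsilon> where "integer_point w" "\<epsilon> > 0" "convex hull {v, v + \<epsilon> *\<^sub>R (w - v)} \<subseteq> S"
      using strongly_regular_simplex_direction S(2) S0(2) by blast
    then show "\<exists>w \<epsilon>. integer_point w \<and> \<epsilon> > 0 \<and> convex hull {v, v + \<epsilon> *\<^sub>R (w - v)} \<subseteq> P"
      using S(1) P by blast
  qed
next
  assume dir: "\<forall>v \<in> P. rational_point v \<longrightarrow>
      (\<exists>w \<epsilon>. integer_point w \<and> \<epsilon> > 0 \<and> convex hull {v, v + \<epsilon> *\<^sub>R (w - v)} \<subseteq> P)"
  show "\<exists>\<T>. strongly_regular_triangulation_of \<T> P"
  proof (cases "P = {}")
    case True
    \<comment> \<open>The fan construction would leave the empty simplex, whose gcd of denominators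
      is 0, so the complex without simplexes is used here.\<close>
    then have "strongly_regular_triangulation_of {} P"
      by (simp add: strongly_regular_triangulation_of_def rational_triangulation_of_def
          simplicial_complex_def)
    then show ?thesis ..
  next
    case False
    obtain \<T> where \<T>: "rational_triangulation_of \<T> P" "\<forall>S\<in>\<T>. regular_simplex S"
      using assms by (rule regular_triangulation_exists)
    have "strongly_regular_simplex S" if S: "S \<in> \<T>" "\<forall>S'\<in>\<T>. S \<subseteq> S' \<longrightarrow> S' = S" for S
    proof -
      \<comment> \<open>The empty simplex lies in every other one, so it could be maximal only if
        \<open>P\<close> were empty.\<close>
      have "S \<noteq> {}"
        using S(2) False \<T>(1) by (auto simp: rational_triangulation_of_def)
      then obtain w where "integer_point w" "w \<in> affine hull S"
        using maximal_simplex_affine_hull[OF \<T>(1) S(1)] S(2) dir by blast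
      then show ?thesis
        using bspec[OF \<T>(2) S(1)] by (intro strongly_regular_simplexI)
    qed
    then show ?thesis
      using \<T>(1) by (auto simp: strongly_regular_triangulation_of_def)
  qed
qed

end
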